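(* Let $n,k$ be integers with $n>2$ and $1<k<n$, and let $s=\left\lfloor \frac{n-2}{k-1}\right\rfloor$. Then the clique number of the 1-skeleton of the polytope $DCMST_{n,k}$ satisfies $$\omega(DCMST_{n,k}) \geq 2^{\left(\sqrt{\left\lfloor \frac{s-1}{2}\right\rfloor}-9\right)/2}.$$
   Context: $K_n$ is the complete graph on an $n$-element vertex set $V$ with edge set $E$, $|E|=d=n(n-1)/2$. For a subgraph $t$ of $K_n$, $x(t)\in\mathbb{R}^d$ (coordinates indexed by $E$) is its characteristic vector: coordinate $1$ for edges of $t$, $0$ otherwise. $DCMST_{n,k}$ is the convex hull of the characteristic vectors of all spanning trees of $K_n$ in which no vertex has degree larger than $k$. The 1-skeleton of a polytope is the graph whose vertices are the polytope's vertices and whose edges are its 1-dimensional faces; $\omega(\cdot)$ denotes its clique number (size of a largest clique). *)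

theory Defs
  imports "HOL-Analysis.Analysis"
begin

definition Kn_edges :: "nat \<Rightarrow> nat set set" where
  "Kn_edges n = {{u, v} | u v. u < n \<and> v < n \<and> u \<noteq> v}"

definition graph_connected :: "nat \<Rightarrow> nat set set \<Rightarrow> bool" where
  "graph_connected n T \<longleftrightarrow>
     (\<forall>u v. u < n \<longrightarrow> v < n \<longrightarrow> (\<lambda>a b. {a, b} \<in> T)\<^sup>*\<^sup>* u v)"

definition spanning_tree :: "nat \<Rightarrow> nat set set \<Rightarrow> bool" where
  "spanning_tree n T \<longleftrightarrow> T \<subseteq> Kn_edges n \<and> graph_connected n T \<and>
     (\<forall>e\<in>T. \<not> graph_connected n (T - {e}))"

definition vdegree :: "nat set set \<Rightarrow> nat \<Rightarrow> nat" where
  "vdegree T v = card {e \<in> T. v \<in> e}"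

text \<open>Characteristic vector in R^E, the coordinates being identified with the
  edges of K_n through a bijection idx from E onto the finite index type 'd.\<close>
definition charvec :: "('d::finite \<Rightarrow> nat set) \<Rightarrow> nat set set \<Rightarrow> real ^ 'd" where
  "charvec eoc T = (\<chi> j. if eoc j \<in> T then 1 else 0)"

definition DCMST :: "nat \<Rightarrow> nat \<Rightarrow> (nat set \<Rightarrow> 'd::finite) \<Rightarrow> (real ^ 'd) set" where
  "DCMST n k idx = convex hull
     {charvec (inv_into (Kn_edges n) idx) T | T. spanning_tree n T \<and> (\<forall>v < n. vdegree T v \<le> k)}"

definition skel_vertices :: "('a::real_vector) set \<Rightarrow> 'a set" where
  "skel_vertices P = {x. x extreme_point_of P}"

definition skel_adjacent :: "('a::real_vector) set \<Rightarrow> 'a \<Rightarrow> 'a \<Rightarrow> bool" where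
  "skel_adjacent P x y \<longleftrightarrow> x \<in> skel_vertices P \<and> y \<in> skel_vertices P \<and> x \<noteq> y \<and>
     closed_segment x y face_of P"

definition skel_clique :: "('a::real_vector) set \<Rightarrow> 'a set \<Rightarrow> bool" where
  "skel_clique P C \<longleftrightarrow> C \<subseteq> skel_vertices P \<and>
     (\<forall>x\<in>C. \<forall>y\<in>C. x \<noteq> y \<longrightarrow> skel_adjacent P x y)"

definition skel_clique_number :: "('a::real_vector) set \<Rightarrow> nat" where
  "skel_clique_number P = Max {card C | C. skel_clique P C}"

end

theory Submission
  imports Defs
begin

text \<open>
  A clique arises from 0/1 vectors such that no third vertex lies between two of them. This property
  starts at the cuts of the complete graph on r + 1 vertices, whose polytope is well known to be
  2-neighbourly, and is transported to trees in two steps.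

  The cuts are the solutions of the constraints \<open>z_ij = z_ir xor z_jr\<close>. A directed path runs
  through one block per constraint, in which three pairwise crossing exchanges can be made, one per
  variable; the block stays connected iff an even number of them is made. All exchanges governed by
  one variable form a single alternating cycle, so every Hamiltonian path in the union of two of
  these paths again comes from a solution.

  Replacing nodes by edges and saturating degrees with pendant leaves turns the directed Hamiltonian
  paths into the degree-constrained trees with a common core.
\<close>

section \<open>Cliques in the skeletons of 0/1 polytopes\<close>

lemma convex_hull_face_of_convex_hull:
  fixes S :: "'a::euclidean_space set"
  assumes "compact S" and le: "\<And>x. x \<in> S \<Longrightarrow> c \<bullet> x \<le> b"
  shows "convex hull {x \<in> S. c \<bullet> x = b} face_of convex hull S"
proof -
  let ?F = "convex hull S \<inter> {x. c \<bullet> x = b}"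
  have "convex hull S \<subseteq> {x. c \<bullet> x \<le> b}"
    by (rule hull_minimal) (use le convex_halfspace_le in auto)
  then have face: "?F face_of convex hull S"
    by (intro face_of_Int_supporting_hyperplane_le) auto
  then obtain S' where S': "S' \<subseteq> S" "?F = convex hull S'"
    using face_of_convex_hull_subset \<open>compact S\<close> by blast
  have "convex hull {x \<in> S. c \<bullet> x = b} = ?F"
  proof
    show "convex hull {x \<in> S. c \<bullet> x = b} \<subseteq> ?F"
      by (rule hull_minimal) (auto intro: hull_inc convex_Int convex_hyperplane)
    have "S' \<subseteq> {x \<in> S. c \<bullet> x = b}" using S' hull_subset[of S' convex] by auto
    then show "?F \<subseteq> convex hull {x \<in> S. c \<bullet> x = b}" unfolding S'(2) by (rule hull_mono)
  qed
  with face show ?thesis by simp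
qed

lemma card_le_skel_clique_number:
  assumes "finite S" "skel_clique (convex hull S) C"
  shows "card C \<le> skel_clique_number (convex hull S)"
proof -
  have "skel_vertices (convex hull S) \<subseteq> S"
    by (auto simp: skel_vertices_def dest: extreme_point_of_convex_hull)
  then have "{card C |C. skel_clique (convex hull S) C} \<subseteq> card ` Pow S"
    by (auto simp: skel_clique_def)
  then have "finite {card C |C. skel_clique (convex hull S) C}"
    by (rule finite_subset) (use assms(1) in simp)
  then show ?thesis
    unfolding skel_clique_number_def by (rule Max_ge) (use assms(2) in blast)
qed

definition set_between :: "'a set \<Rightarrow> 'a set \<Rightarrow> 'a set set" where
  "set_between X Y = {Z. X \<inter> Y \<subseteq> Z \<and> Z \<subseteq> X \<union> Y}"

lemma set_between_iff: "Z \<in> set_between X Y \<longleftrightarrow> X \<inter> Y \<subseteq> Z \<and> Z \<subseteq> X \<union> Y"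
  by (simp add: set_between_def)

lemma set_between_self [simp]: "set_between X X = {X}"
  by (auto simp: set_between_def)

definition between_free :: "'a set set \<Rightarrow> 'a set set \<Rightarrow> bool" where
  "between_free \<T> \<F> \<longleftrightarrow> \<F> \<subseteq> \<T> \<and> (\<forall>X\<in>\<F>. \<forall>Y\<in>\<F>. \<T> \<inter> set_between X Y \<subseteq> {X, Y})"

lemma between_free_image:
  assumes "between_free \<T> \<F>" "\<phi> ` \<T> \<subseteq> \<T>'"
    and "\<And>X Y. X \<in> \<T> \<Longrightarrow> Y \<in> \<T> \<Longrightarrow> \<T>' \<inter> set_between (\<phi> X) (\<phi> Y) \<subseteq> \<phi> ` (\<T> \<inter> set_between X Y)"
  shows "between_free \<T>' (\<phi> ` \<F>)"
  unfolding between_free_def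
proof (intro conjI ballI)
  have "\<F> \<subseteq> \<T>" using assms(1) by (simp add: between_free_def)
  then show "\<phi> ` \<F> \<subseteq> \<T>'" using assms(2) by blast
  fix X' Y' assume "X' \<in> \<phi> ` \<F>" "Y' \<in> \<phi> ` \<F>"
  then obtain X Y where XY: "X \<in> \<F>" "Y \<in> \<F>" "X' = \<phi> X" "Y' = \<phi> Y" by blast
  then have "\<T>' \<inter> set_between X' Y' \<subseteq> \<phi> ` (\<T> \<inter> set_between X Y)"
    using assms(3) \<open>\<F> \<subseteq> \<T>\<close> by blast
  also have "\<dots> \<subseteq> \<phi> ` {X, Y}"
    using assms(1) XY(1,2) unfolding between_free_def by blast
  finally show "\<T>' \<inter> set_between X' Y' \<subseteq> {X', Y'}" using XY(3,4) by simp
qed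

lemma charvec_eq_iff:
  assumes "S \<subseteq> range eoc" "T \<subseteq> range eoc"
  shows "charvec eoc S = charvec eoc T \<longleftrightarrow> S = T"
proof
  assume "charvec eoc S = charvec eoc T"
  then have "eoc j \<in> S \<longleftrightarrow> eoc j \<in> T" for j
    by (auto simp: charvec_def vec_eq_iff split: if_splits)
  then show "S = T" using assms by blast
qed simp

definition between_functional ::
  "('d::finite \<Rightarrow> nat set) \<Rightarrow> nat set set \<Rightarrow> nat set set \<Rightarrow> real ^ 'd" where
  "between_functional eoc X Y =
     (\<chi> j. if eoc j \<in> X \<inter> Y then 1 else if eoc j \<in> X \<union> Y then 0 else -1)"

lemma between_functional_charvec:
  fixes eoc :: "'d::finite \<Rightarrow> nat set"
  assumes "X \<subseteq> range eoc" "T \<subseteq> range eoc"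
  shows "between_functional eoc X Y \<bullet> charvec eoc T \<le> real (card {j. eoc j \<in> X \<inter> Y})" (is ?le)
    and "between_functional eoc X Y \<bullet> charvec eoc T = real (card {j. eoc j \<in> X \<inter> Y}) \<longleftrightarrow>
      T \<in> set_between X Y" (is ?eq)
proof -
  define loss :: "'d \<Rightarrow> real" where
    "loss j = (if eoc j \<in> X \<inter> Y - T \<or> eoc j \<in> T - (X \<union> Y) then 1 else 0)" for j
  have "real (card {j. eoc j \<in> X \<inter> Y}) = (\<Sum>j\<in>UNIV. if eoc j \<in> X \<inter> Y then 1 else 0)"
    by (simp add: sum.If_cases)
  moreover have "between_functional eoc X Y $ j * charvec eoc T $ j
      = (if eoc j \<in> X \<inter> Y then 1 else 0) - loss j" for j
    by (simp add: between_functional_def charvec_def loss_def)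
  ultimately have diff: "between_functional eoc X Y \<bullet> charvec eoc T
      = real (card {j. eoc j \<in> X \<inter> Y}) - (\<Sum>j\<in>UNIV. loss j)"
    by (simp add: inner_vec_def sum_subtractf)
  have loss_nonneg: "0 \<le> loss j" for j by (simp add: loss_def)
  then show ?le using diff by (simp add: sum_nonneg)
  have "(\<Sum>j\<in>UNIV. loss j) = 0 \<longleftrightarrow> (\<forall>j. loss j = 0)"
    by (simp add: sum_nonneg_eq_0_iff loss_nonneg)
  also have "\<dots> \<longleftrightarrow> (\<forall>e\<in>range eoc. e \<notin> X \<inter> Y - T \<and> e \<notin> T - (X \<union> Y))"
    by (auto simp: loss_def)
  also have "\<dots> \<longleftrightarrow> T \<in> set_between X Y"
    using assms by (auto simp: set_between_iff)
  finally show ?eq using diff by simp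
qed

lemma closed_segment_charvec_face_of:
  fixes eoc :: "'d::finite \<Rightarrow> nat set"
  assumes \<T>: "\<T> \<subseteq> Pow (range eoc)" and "X \<in> \<T>" "Y \<in> \<T>" "\<T> \<inter> set_between X Y \<subseteq> {X, Y}"
  shows "closed_segment (charvec eoc X) (charvec eoc Y) face_of convex hull (charvec eoc ` \<T>)"
proof -
  let ?c = "between_functional eoc X Y" and ?b = "real (card {j. eoc j \<in> X \<inter> Y})"
  have in_range: "T \<subseteq> range eoc" if "T \<in> \<T>" for T using that \<T> by blast
  have "finite \<T>" using \<T> by (rule finite_subset) simp
  then have "compact (charvec eoc ` \<T>)" by (simp add: finite_imp_compact)
  moreover have "?c \<bullet> x \<le> ?b" if "x \<in> charvec eoc ` \<T>" for x
    using that between_functional_charvec(1)[OF in_range[OF \<open>X \<in> \<T>\<close>] in_range] by auto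
  ultimately have
    "convex hull {x \<in> charvec eoc ` \<T>. ?c \<bullet> x = ?b} face_of convex hull (charvec eoc ` \<T>)"
    by (rule convex_hull_face_of_convex_hull)
  also have "{x \<in> charvec eoc ` \<T>. ?c \<bullet> x = ?b} = charvec eoc ` (\<T> \<inter> set_between X Y)"
    using between_functional_charvec(2)[OF in_range[OF \<open>X \<in> \<T>\<close>] in_range] by auto
  also have "\<T> \<inter> set_between X Y = {X, Y}"
    using assms by (auto simp: set_between_iff)
  finally show ?thesis by (simp add: segment_convex_hull)
qed

lemma card_le_skel_clique_number_charvec:
  fixes eoc :: "'d::finite \<Rightarrow> nat set"
  assumes \<T>: "\<T> \<subseteq> Pow (range eoc)" and "between_free \<T> \<F>"
  shows "card \<F> \<le> skel_clique_number (convex hull (charvec eoc ` \<T>))"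
proof -
  have "\<F> \<subseteq> \<T>" and free: "\<And>X Y. X \<in> \<F> \<Longrightarrow> Y \<in> \<F> \<Longrightarrow> \<T> \<inter> set_between X Y \<subseteq> {X, Y}"
    using assms(2) by (auto simp: between_free_def)
  then have face:
    "closed_segment (charvec eoc X) (charvec eoc Y) face_of convex hull (charvec eoc ` \<T>)"
    if "X \<in> \<F>" "Y \<in> \<F>" for X Y
    using that by (intro closed_segment_charvec_face_of[OF \<T>]) auto
  then have "charvec eoc X extreme_point_of convex hull (charvec eoc ` \<T>)" if "X \<in> \<F>" for X
    using that face[of X X] by (simp add: face_of_singleton)
  with face have "skel_clique (convex hull (charvec eoc ` \<T>)) (charvec eoc ` \<F>)"
    by (auto simp: skel_clique_def skel_adjacent_def skel_vertices_def)
  moreover have "finite \<T>" using \<T> by (rule finite_subset) simp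
  ultimately have "card (charvec eoc ` \<F>) \<le> skel_clique_number (convex hull (charvec eoc ` \<T>))"
    by (intro card_le_skel_clique_number) simp_all
  moreover have "inj_on (charvec eoc) \<F>"
    using \<T> \<open>\<F> \<subseteq> \<T>\<close> by (intro inj_onI) (metis charvec_eq_iff PowD subsetD)
  ultimately show ?thesis by (simp add: card_image)
qed

section \<open>Degree-constrained spanning trees\<close>

definition dc_tree :: "nat \<Rightarrow> nat \<Rightarrow> nat set set \<Rightarrow> bool" where
  "dc_tree n k T \<longleftrightarrow> spanning_tree n T \<and> (\<forall>v<n. vdegree T v \<le> k)"

lemma dc_tree_subset: "dc_tree n k T \<Longrightarrow> T \<subseteq> Kn_edges n"
  by (simp add: dc_tree_def spanning_tree_def)

lemma dc_tree_mono: "dc_tree n k T \<Longrightarrow> k \<le> l \<Longrightarrow> dc_tree n l T"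
  by (auto simp: dc_tree_def intro: order_trans)

lemma card_le_skel_clique_number_DCMST:
  fixes idx :: "nat set \<Rightarrow> 'd::finite"
  assumes "bij_betw idx (Kn_edges n) UNIV" "between_free {T. dc_tree n k T} \<F>"
  shows "card \<F> \<le> skel_clique_number (DCMST n k idx)"
proof -
  let ?eoc = "inv_into (Kn_edges n) idx"
  have "range ?eoc = Kn_edges n"
    using bij_betw_inv_into[OF assms(1)] by (rule bij_betw_imp_surj_on)
  then have "{T. dc_tree n k T} \<subseteq> Pow (range ?eoc)" by (auto dest: dc_tree_subset[THEN subsetD])
  moreover have "DCMST n k idx = convex hull (charvec ?eoc ` {T. dc_tree n k T})"
    by (simp add: DCMST_def dc_tree_def image_Collect)
  ultimately show ?thesis using card_le_skel_clique_number_charvec assms(2) by metis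
qed

lemma finite_Kn_edges [simp]: "finite (Kn_edges n)"
  by (rule finite_subset[of _ "Pow {..<n}"]) (auto simp: Kn_edges_def)

text \<open>Each vertex other than 0 is charged with the edge to its parent in a breadth-first tree.\<close>

lemma graph_connected_card_ge:
  assumes "graph_connected n T" "finite T"
  shows "n \<le> card T + 1"
proof (cases "n = 0")
  case False
  define R where "R = (\<lambda>a b. {a, b} \<in> T)"
  define depth where "depth v = (LEAST m. (R ^^ m) 0 v)" for v
  have "\<exists>p. depth p < depth v \<and> {p, v} \<in> T" if v: "v \<in> {1..<n}" for v
  proof -
    have "R\<^sup>*\<^sup>* 0 v"
      using assms(1) v False by (simp add: graph_connected_def R_def)
    then obtain m where "(R ^^ m) 0 v" by (auto simp: rtranclp_power)
    then have path: "(R ^^ depth v) 0 v" unfolding depth_def by (rule LeastI)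
    with v obtain m where m: "depth v = Suc m" by (cases "depth v") auto
    with path obtain p where p: "(R ^^ m) 0 p" "R p v" by auto
    from p(1) have "depth p \<le> m" unfolding depth_def by (rule Least_le)
    with p(2) m show ?thesis unfolding R_def by (metis le_imp_less_Suc)
  qed
  then obtain parent
    where parent: "\<And>v. v \<in> {1..<n} \<Longrightarrow> depth (parent v) < depth v \<and> {parent v, v} \<in> T"
    by metis
  have "inj_on (\<lambda>v. {parent v, v}) {1..<n}"
    by (rule inj_onI) (metis parent doubleton_eq_iff less_asym)
  then have "card {1..<n} \<le> card T"
    by (rule card_inj_on_le) (use parent assms(2) in auto)
  then show ?thesis by simp
qed simp

lemma spanning_treeI:
  assumes "T \<subseteq> Kn_edges n" "graph_connected n T" "card T < n"
  shows "spanning_tree n T"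
  unfolding spanning_tree_def
proof (intro conjI ballI notI)
  fix e assume e: "e \<in> T" "graph_connected n (T - {e})"
  have "finite T" using assms(1) by (rule finite_subset) simp
  then have "card (T - {e}) < card T" using e(1) by (rule card_Diff1_less)
  with graph_connected_card_ge[OF e(2)] \<open>finite T\<close> assms(3) show False by simp
qed (use assms in auto)

lemma graph_connectedI:
  assumes "\<And>v. v < n \<Longrightarrow> (\<lambda>a b. {a, b} \<in> T)\<^sup>*\<^sup>* c v"
  shows "graph_connected n T"
  unfolding graph_connected_def
proof (intro allI impI)
  fix u v assume uv: "u < n" "v < n"
  have "symp (\<lambda>a b. {a, b} \<in> T)" by (auto simp: symp_def insert_commute)
  then have "symp (\<lambda>a b. {a, b} \<in> T)\<^sup>*\<^sup>*" by (rule symp_rtranclp)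
  then have "(\<lambda>a b. {a, b} \<in> T)\<^sup>*\<^sup>* u c" using assms[OF uv(1)] by (rule sympD)
  then show "(\<lambda>a b. {a, b} \<in> T)\<^sup>*\<^sup>* u v" using assms[OF uv(2)] by (rule rtranclp_trans)
qed

lemma vdegree_Un_disjoint:
  assumes "finite S" "finite T" "S \<inter> T = {}"
  shows "vdegree (S \<union> T) v = vdegree S v + vdegree T v"
proof -
  have "{e \<in> S \<union> T. v \<in> e} = {e \<in> S. v \<in> e} \<union> {e \<in> T. v \<in> e}" by blast
  then show ?thesis
    unfolding vdegree_def using assms by (subst card_Un_disjoint[symmetric]) auto
qed

lemma vdegree_eq_card:
  assumes "{e \<in> T. v \<in> e} = (\<lambda>u. {v, u}) ` X"
  shows "vdegree T v = card X"
proof -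
  have "inj_on (\<lambda>u. {v, u}) X" by (auto simp: inj_on_def doubleton_eq_iff)
  then show ?thesis by (simp add: vdegree_def assms card_image)
qed

lemma vdegree_parent_edges:
  fixes par :: "nat \<Rightarrow> nat"
  assumes "finite X" and less: "\<And>u. u \<in> X \<Longrightarrow> par u < u"
  shows "vdegree ((\<lambda>u. {par u, u}) ` X) v = card {u \<in> X. par u = v} + (if v \<in> X then 1 else 0)"
proof -
  let ?Y = "{u \<in> X. par u = v} \<union> (if v \<in> X then {par v} else {})"
  have "{e \<in> (\<lambda>u. {par u, u}) ` X. v \<in> e} = (\<lambda>u. {v, u}) ` ?Y"
    by (auto split: if_splits)
  then have "vdegree ((\<lambda>u. {par u, u}) ` X) v = card ?Y" by (rule vdegree_eq_card)
  moreover have "par v \<notin> {u \<in> X. par u = v}" if "v \<in> X"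
    using less[OF that] less[of "par v"] by auto
  ultimately show ?thesis using assms(1) by simp
qed

section \<open>Directed Hamiltonian paths\<close>

definition hamiltonian_path :: "'v set \<Rightarrow> 'v \<Rightarrow> 'v rel \<Rightarrow> bool" where
  "hamiltonian_path V s A \<longleftrightarrow>
     A \<subseteq> V \<times> V \<and> single_valued A \<and> single_valued (A\<inverse>) \<and> s \<notin> Range A \<and> V \<subseteq> A\<^sup>* `` {s}"

lemma rtrancl_Image_subset_Range: "A\<^sup>* `` {s} \<subseteq> insert s (Range A)"
  by (auto elim: rtranclE)

lemma hamiltonian_path_irrefl:
  assumes "hamiltonian_path V s A"
  shows "(v, v) \<notin> A"
proof
  assume v: "(v, v) \<in> A"
  have "v \<in> V" using assms v by (auto simp: hamiltonian_path_def)
  then have "(s, v) \<in> A\<^sup>*" using assms by (auto simp: hamiltonian_path_def)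
  moreover have "x \<noteq> v" if "(s, x) \<in> A\<^sup>*" for x
    using that
  proof (induction rule: rtrancl_induct)
    case base
    then show ?case using assms v by (auto simp: hamiltonian_path_def)
  next
    case (step x y)
    then show ?case using assms v unfolding hamiltonian_path_def single_valued_def by blast
  qed
  ultimately show False by blast
qed

lemma Range_hamiltonian_path:
  assumes "hamiltonian_path V s A"
  shows "Range A = V - {s}"
  using assms rtrancl_Image_subset_Range[of A s] by (auto simp: hamiltonian_path_def)

lemma card_hamiltonian_path:
  assumes "hamiltonian_path V s A" "finite V" "s \<in> V"
  shows "card A + 1 = card V"
proof -
  have "inj_on snd A"
    using assms(1) by (auto simp: hamiltonian_path_def single_valued_def inj_on_def)
  then have "card A = card (Range A)" by (simp add: Range_snd card_image)
  also have "\<dots> = card (V - {s})" by (simp add: Range_hamiltonian_path[OF assms(1)])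
  finally show ?thesis using card_Suc_Diff1[OF assms(2,3)] by simp
qed

lemma hamiltonian_path_graphI:
  assumes "finite V" "s \<in> V" "t \<in> V" and f: "f ` (V - {t}) \<subseteq> V"
    and reach: "V \<subseteq> ((\<lambda>v. (v, f v)) ` (V - {t}))\<^sup>* `` {s}"
  shows "hamiltonian_path V s ((\<lambda>v. (v, f v)) ` (V - {t}))" (is "hamiltonian_path V s ?A")
proof -
  have Range: "Range ?A = f ` (V - {t})" by auto
  have "V - {s} \<subseteq> f ` (V - {t})"
    using reach rtrancl_Image_subset_Range[of ?A s] unfolding Range by blast
  moreover have "card (f ` (V - {t})) \<le> card (V - {s})"
    using card_image_le[of "V - {t}" f] assms(1-3) by simp
  ultimately have img: "f ` (V - {t}) = V - {s}"
    using assms(1) by (intro card_seteq[symmetric]) auto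
  then have "inj_on f (V - {t})"
    using assms(1-3) by (intro eq_card_imp_inj_on) auto
  then have "single_valued (?A\<inverse>)" by (auto simp: single_valued_def inj_on_def)
  moreover have "single_valued ?A" by (auto simp: single_valued_def)
  moreover have "s \<notin> Range ?A" unfolding Range img by simp
  ultimately show ?thesis using f reach by (auto simp: hamiltonian_path_def)
qed

lemma single_valued_iff_card_Image_le:
  assumes "finite (Range R)"
  shows "single_valued R \<longleftrightarrow> (\<forall>v. card (R `` {v}) \<le> 1)"
proof -
  have "finite (R `` {v})" for v by (rule finite_subset[OF _ assms]) auto
  then show ?thesis by (auto simp: single_valued_def card_le_Suc0_iff_eq)
qed

section \<open>Trees from directed Hamiltonian paths\<close>

text \<open>A node v becomes the edge between its entrance \<open>inn v\<close> and its exit \<open>out v\<close>. Each of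
  the 2N core vertices carries k - 2 leaves, so a tree of maximal degree k has at most one arc edge
  at it. The leftover vertices form a chain hanging from the entrance of \<open>src\<close>, which no arc
  enters.\<close>

locale path_embedding =
  fixes n k N :: nat and V :: "'v set" and enc :: "'v \<Rightarrow> nat" and src :: 'v
  assumes enc: "bij_betw enc V {..<N}"
    and src_in_V: "src \<in> V"
    and k_ge_2: "2 \<le> k"
    and size: "2 * N * (k - 1) \<le> n"
begin

definition inn :: "'v \<Rightarrow> nat" where "inn v = 2 * enc v"
definition out :: "'v \<Rightarrow> nat" where "out v = 2 * enc v + 1"

definition core_end :: nat where "core_end = 2 * N * (k - 1)"

definition anchor :: "nat \<Rightarrow> nat" where
  "anchor u = (if u < core_end then u mod (2 * N) else inn src)"

definition par :: "nat \<Rightarrow> nat" where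
  "par u = (if u \<le> core_end then anchor u else u - 1)"

definition node_edges :: "nat set set" where
  "node_edges = (\<lambda>v. {inn v, out v}) ` V"

definition hung_edges :: "nat set set" where
  "hung_edges = (\<lambda>u. {par u, u}) ` {2 * N..<n}"

definition arc_edge :: "'v \<times> 'v \<Rightarrow> nat set" where
  "arc_edge = (\<lambda>(v, w). {out v, inn w})"

definition tree :: "'v rel \<Rightarrow> nat set set" where
  "tree A = node_edges \<union> hung_edges \<union> arc_edge ` A"

definition arcs_available :: "'v rel" where
  "arcs_available = {(v, w) \<in> V \<times> V. v \<noteq> w \<and> w \<noteq> src}"

lemma finite_V: "finite V" and card_V: "card V = N"
  using bij_betw_finite[OF enc] bij_betw_same_card[OF enc] by simp_all

lemma core_le_core_end: "2 * N \<le> core_end" and core_end_le: "core_end \<le> n"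
proof -
  have "2 * N * 1 \<le> 2 * N * (k - 1)" using k_ge_2 by (intro mult_left_mono) auto
  then show "2 * N \<le> core_end" "core_end \<le> n"
    using size by (simp_all only: core_end_def mult_1_right)
qed

lemma inn_less: "v \<in> V \<Longrightarrow> inn v < 2 * N" and out_less: "v \<in> V \<Longrightarrow> out v < 2 * N"
  using bij_betwE[OF enc] by (fastforce simp: inn_def out_def)+

lemma N_pos: "0 < N"
  using inn_less[OF src_in_V] by simp

lemma inn_neq_out [simp]: "inn v \<noteq> out w" "out w \<noteq> inn v"
  unfolding inn_def out_def by presburger+

lemma inj_on_inn: "inj_on inn V" and inj_on_out: "inj_on out V"
  using bij_betw_imp_inj_on[OF enc] by (auto simp: inj_on_def inn_def out_def)

lemmas inn_eq_iff [simp] = inj_on_eq_iff[OF inj_on_inn]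
  and out_eq_iff [simp] = inj_on_eq_iff[OF inj_on_out]

lemma core_cases:
  assumes "c < 2 * N"
  obtains (inn) v where "v \<in> V" "c = inn v" | (out) v where "v \<in> V" "c = out v"
proof -
  have "c div 2 \<in> enc ` V" using enc assms by (auto simp: bij_betw_def)
  then obtain v where v: "v \<in> V" "c div 2 = enc v" by blast
  have "c = inn v \<or> c = out v" using v(2) unfolding inn_def out_def by presburger
  with v that show thesis by blast
qed

lemma anchor_less: "anchor u < 2 * N"
  using N_pos inn_less[OF src_in_V] by (simp add: anchor_def)

lemma par_less: "2 * N \<le> u \<Longrightarrow> par u < u"
  using anchor_less[of u] core_le_core_end by (auto simp: par_def)

lemma anchor_par: "2 * N \<le> u \<Longrightarrow> anchor (par u) = anchor u"
  using anchor_less[of u] core_le_core_end by (auto simp: par_def anchor_def)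

lemma tree_cases:
  assumes "e \<in> tree A"
  obtains (node) v where "v \<in> V" "e = {inn v, out v}"
    | (hung) u where "2 * N \<le> u" "u < n" "e = {par u, u}"
    | (arc) v w where "(v, w) \<in> A" "e = {out v, inn w}"
  using assms by (auto simp: tree_def node_edges_def hung_edges_def arc_edge_def)

lemma tree_subset:
  assumes "A \<subseteq> V \<times> V"
  shows "tree A \<subseteq> Kn_edges n"
proof
  have pair: "{a, b} \<in> Kn_edges n" if "a < n" "b < n" "a \<noteq> b" for a b
    using that by (auto simp: Kn_edges_def)
  have core: "inn v < n" "out v < n" if "v \<in> V" for v
    using inn_less[OF that] out_less[OF that] core_le_core_end core_end_le by simp_all
  fix e assume "e \<in> tree A"
  then show "e \<in> Kn_edges n"
  proof (cases rule: tree_cases)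
    case (hung u)
    then show ?thesis using par_less[of u] by (auto intro!: pair)
  qed (use core assms in \<open>auto intro!: pair\<close>)
qed

lemma finite_tree: "A \<subseteq> V \<times> V \<Longrightarrow> finite (tree A)"
  by (rule finite_subset[OF tree_subset]) simp_all

lemma card_tree_le:
  assumes "A \<subseteq> V \<times> V"
  shows "card (tree A) \<le> (n - N) + card A"
proof -
  have "finite A" using assms finite_V finite_subset by blast
  have "card (tree A) \<le> card node_edges + card hung_edges + card (arc_edge ` A)"
    unfolding tree_def using card_Un_le[of "node_edges \<union> hung_edges"] card_Un_le[of node_edges]
    by (meson add_right_mono order_trans)
  also have "\<dots> \<le> card V + card {2 * N..<n} + card A"
    unfolding node_edges_def hung_edges_def
    using finite_V \<open>finite A\<close> by (intro add_mono card_image_le) auto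
  also have "\<dots> = (n - N) + card A"
    using card_V core_le_core_end core_end_le by simp
  finally show ?thesis .
qed

lemma core_edges_subset:
  assumes "A \<subseteq> arcs_available" "e \<in> node_edges \<union> arc_edge ` A"
  shows "e \<subseteq> {..<2 * N}"
  using assms inn_less out_less
  by (auto simp: node_edges_def arc_edge_def arcs_available_def)

lemma core_edges_disjoint:
  assumes "A \<subseteq> arcs_available"
  shows "node_edges \<inter> hung_edges = {}" "(node_edges \<union> hung_edges) \<inter> arc_edge ` A = {}"
proof -
  note core_edges_subset[OF assms]
  moreover have "\<not> e \<subseteq> {..<2 * N}" if "e \<in> hung_edges" for e
    using that by (auto simp: hung_edges_def)
  moreover have "node_edges \<inter> arc_edge ` A = {}"
    using assms by (auto simp: node_edges_def arc_edge_def arcs_available_def doubleton_eq_iff)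
  ultimately show "node_edges \<inter> hung_edges = {}" "(node_edges \<union> hung_edges) \<inter> arc_edge ` A = {}"
    by blast+
qed

lemma inj_on_tree: "inj_on tree (Pow arcs_available)"
proof (rule inj_onI)
  fix A A' assume A: "A \<in> Pow arcs_available" "A' \<in> Pow arcs_available" and eq: "tree A = tree A'"
  have "arc_edge ` B = tree B - (node_edges \<union> hung_edges)" if "B \<in> Pow arcs_available" for B
    using core_edges_disjoint(2)[of B] that by (auto simp: tree_def)
  then have "arc_edge ` A = arc_edge ` A'" using A eq by simp
  moreover have "inj_on arc_edge arcs_available"
    by (auto simp: inj_on_def arc_edge_def arcs_available_def doubleton_eq_iff)
  ultimately show "A = A'" using A by (simp add: inj_on_image_eq_iff)
qed

definition children :: "nat \<Rightarrow> nat set" where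
  "children c = {u \<in> {2 * N..<n}. par u = c}"

definition leaves :: "nat \<Rightarrow> nat set" where
  "leaves c = (\<lambda>t. t * (2 * N) + c) ` {1..<k - 1}"

lemma leaves_eq:
  assumes "c < 2 * N"
  shows "leaves c = {u \<in> {2 * N..<core_end}. u mod (2 * N) = c}"
proof (intro equalityI subsetI)
  fix u assume "u \<in> leaves c"
  then obtain t where t: "1 \<le> t" "t < k - 1" "u = t * (2 * N) + c" by (auto simp: leaves_def)
  have "(t + 1) * (2 * N) \<le> (k - 1) * (2 * N)" "1 * (2 * N) \<le> t * (2 * N)"
    using t by (intro mult_right_mono; simp)+
  then have "2 * N \<le> u" "u < core_end" using t assms by (simp_all add: core_end_def algebra_simps)
  moreover have "u mod (2 * N) = c" using t assms by simp
  ultimately show "u \<in> {u \<in> {2 * N..<core_end}. u mod (2 * N) = c}" by simp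
next
  fix u assume u: "u \<in> {u \<in> {2 * N..<core_end}. u mod (2 * N) = c}"
  then have "u = u div (2 * N) * (2 * N) + c" using div_mult_mod_eq[of u "2 * N"] by simp
  moreover have "u div (2 * N) < k - 1"
    using u by (simp add: core_end_def less_mult_imp_div_less mult.commute)
  moreover have "1 \<le> u div (2 * N)"
    using u N_pos by (simp add: div_greater_zero_iff Suc_le_eq)
  ultimately show "u \<in> leaves c" unfolding leaves_def by (metis atLeastLessThan_iff image_eqI)
qed

lemma card_children_core:
  assumes "c < 2 * N"
  shows "card (children c) = k - 2 + (if c = inn src \<and> core_end < n then 1 else 0)"
proof -
  have "children c =
      leaves c \<union> (if c = inn src \<and> core_end < n then {core_end} else {})"
    unfolding leaves_eq[OF assms] children_def using assms core_le_core_end core_end_le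
    by (auto simp: par_def anchor_def)
  moreover have "card (leaves c) = k - 2"
    unfolding leaves_def using N_pos by (subst card_image) (auto simp: inj_on_def)
  moreover have "core_end \<notin> leaves c" "finite (leaves c)"
    by (simp_all add: leaves_eq[OF assms])
  ultimately show ?thesis by auto
qed

lemma card_children_hung_le:
  assumes "2 * N \<le> c"
  shows "card (children c) \<le> 1"
proof -
  have "u = c + 1" if "par u = c" for u
    using that assms anchor_less[of u] by (auto simp: par_def split: if_splits)
  then have "children c \<subseteq> {c + 1}" by (auto simp: children_def)
  then show ?thesis using card_mono[of "{c + 1}"] by simp
qed

lemma vdegree_tree:
  assumes "A \<subseteq> arcs_available"
  shows "vdegree (tree A) c = vdegree node_edges c + card (children c)
    + (if c \<in> {2 * N..<n} then 1 else 0) + vdegree (arc_edge ` A) c"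
proof -
  have "finite (tree A)" using assms by (intro finite_tree) (auto simp: arcs_available_def)
  then have "vdegree (tree A) c =
      vdegree node_edges c + vdegree hung_edges c + vdegree (arc_edge ` A) c"
    unfolding tree_def using core_edges_disjoint[OF assms] by (simp add: vdegree_Un_disjoint)
  also have "vdegree hung_edges c =
      card (children c) + (if c \<in> {2 * N..<n} then 1 else 0)"
    unfolding hung_edges_def children_def by (rule vdegree_parent_edges) (simp_all add: par_less)
  finally show ?thesis by simp
qed

lemma vdegree_tree_out:
  assumes A: "A \<subseteq> arcs_available" and v: "v \<in> V"
  shows "vdegree (tree A) (out v) = k - 1 + card (A `` {v})"
proof -
  have "vdegree node_edges (out v) = card {inn v}"
    by (rule vdegree_eq_card) (use v in \<open>auto simp: node_edges_def\<close>)
  moreover have "vdegree (arc_edge ` A) (out v) = card (inn ` (A `` {v}))"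
    by (rule vdegree_eq_card) (use A v in \<open>fastforce simp: arc_edge_def arcs_available_def\<close>)
  moreover have "inj_on inn (A `` {v})"
    by (rule inj_on_subset[OF inj_on_inn]) (use A in \<open>auto simp: arcs_available_def\<close>)
  ultimately show ?thesis
    using k_ge_2 out_less[OF v]
    by (simp add: vdegree_tree[OF A] card_children_core card_image)
qed

lemma vdegree_tree_inn:
  assumes A: "A \<subseteq> arcs_available" and v: "v \<in> V"
  shows "vdegree (tree A) (inn v) =
    k - 1 + card (A\<inverse> `` {v}) + (if v = src \<and> core_end < n then 1 else 0)"
proof -
  have "vdegree node_edges (inn v) = card {out v}"
    by (rule vdegree_eq_card) (use v in \<open>auto simp: node_edges_def\<close>)
  moreover have "vdegree (arc_edge ` A) (inn v) = card (out ` (A\<inverse> `` {v}))"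
    by (rule vdegree_eq_card) (use A v in \<open>fastforce simp: arc_edge_def arcs_available_def\<close>)
  moreover have "inj_on out (A\<inverse> `` {v})"
    by (rule inj_on_subset[OF inj_on_out]) (use A in \<open>auto simp: arcs_available_def\<close>)
  ultimately show ?thesis
    using k_ge_2 src_in_V v inn_less[OF v]
    by (simp add: vdegree_tree[OF A] card_children_core card_image)
qed

lemma vdegree_tree_hung_le:
  assumes A: "A \<subseteq> arcs_available" and c: "2 * N \<le> c"
  shows "vdegree (tree A) c \<le> 2"
proof -
  have "c \<notin> e" if "e \<in> node_edges \<union> arc_edge ` A" for e
    using core_edges_subset[OF A that] c by auto
  then have "{e \<in> node_edges. c \<in> e} = {}" "{e \<in> arc_edge ` A. c \<in> e} = {}" by blast+
  then have "vdegree node_edges c = 0" "vdegree (arc_edge ` A) c = 0"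
    by (simp_all only: vdegree_def card.empty)
  then show ?thesis using card_children_hung_le[OF c] by (simp add: vdegree_tree[OF A])
qed

lemma vdegree_tree_le_iff:
  assumes A: "A \<subseteq> arcs_available"
  shows "(\<forall>c<n. vdegree (tree A) c \<le> k) \<longleftrightarrow> single_valued A \<and> single_valued (A\<inverse>)"
proof -
  have "finite A"
    using A finite_V by (auto simp: arcs_available_def intro: finite_subset[of A "V \<times> V"])
  then have fin: "finite (Range A)" "finite (Range (A\<inverse>))"
    by (simp_all add: finite_Range finite_Domain)
  have out: "vdegree (tree A) (out v) \<le> k \<longleftrightarrow> card (A `` {v}) \<le> 1" if "v \<in> V" for v
    using k_ge_2 by (auto simp: vdegree_tree_out[OF A that])
  have inn: "vdegree (tree A) (inn v) \<le> k \<longleftrightarrow> card (A\<inverse> `` {v}) \<le> 1" if "v \<in> V" for v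
  proof -
    have "A\<inverse> `` {src} = {}" using A by (auto simp: arcs_available_def)
    then show ?thesis using k_ge_2 by (auto simp: vdegree_tree_inn[OF A that])
  qed
  have core: "inn v < n" "out v < n" if "v \<in> V" for v
    using inn_less[OF that] out_less[OF that] core_le_core_end core_end_le by simp_all
  have outside: "A `` {v} = {}" "A\<inverse> `` {v} = {}" if "v \<notin> V" for v
    using that A by (auto simp: arcs_available_def)
  have "vdegree (tree A) c \<le> k" if "\<forall>v\<in>V. card (A `` {v}) \<le> 1 \<and> card (A\<inverse> `` {v}) \<le> 1" for c
  proof (cases "c < 2 * N")
    case True
    then show ?thesis by (cases rule: core_cases) (use that out inn in auto)
  next
    case False
    then show ?thesis using vdegree_tree_hung_le[OF A, of c] k_ge_2 by simp
  qed
  then have "(\<forall>c<n. vdegree (tree A) c \<le> k) \<longleftrightarrow>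
      (\<forall>v\<in>V. card (A `` {v}) \<le> 1 \<and> card (A\<inverse> `` {v}) \<le> 1)"
    using out inn core by blast
  also have "\<dots> \<longleftrightarrow> (\<forall>v. card (A `` {v}) \<le> 1) \<and> (\<forall>v. card (A\<inverse> `` {v}) \<le> 1)"
    using outside by (metis card.empty zero_le_one)
  finally show ?thesis using fin by (simp add: single_valued_iff_card_Image_le)
qed

lemma graph_connected_tree:
  assumes reach: "V \<subseteq> A\<^sup>* `` {src}" and A: "A \<subseteq> V \<times> V"
  shows "graph_connected n (tree A)"
proof (rule graph_connectedI)
  let ?R = "\<lambda>a b. {a, b} \<in> tree A"
  have node: "?R (inn v) (out v)" if "v \<in> V" for v
    using that by (auto simp: tree_def node_edges_def)
  have inn: "?R\<^sup>*\<^sup>* (inn src) (inn v)" if "(src, v) \<in> A\<^sup>*" for v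
    using that
  proof (induction rule: rtrancl_induct)
    case (step v w)
    then have "?R (inn v) (out v)" "?R (out v) (inn w)"
      using node A by (auto simp: tree_def arc_edge_def)
    with step.IH show ?case by (meson rtranclp.rtrancl_into_rtrancl)
  qed simp
  fix c assume "c < n"
  then show "?R\<^sup>*\<^sup>* (inn src) c"
  proof (induction c rule: less_induct)
    case (less c)
    show ?case
    proof (cases "c < 2 * N")
      case True
      then show ?thesis
        by (cases rule: core_cases)
          (use inn reach node in \<open>auto intro: rtranclp.rtrancl_into_rtrancl\<close>)
    next
      case False
      then have "?R (par c) c" using less.prems by (auto simp: tree_def hung_edges_def)
      moreover have "?R\<^sup>*\<^sup>* (inn src) (par c)"
        using False par_less[of c] less by (intro less.IH) simp_all
      ultimately show ?thesis by (rule rtranclp.rtrancl_into_rtrancl[rotated])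
    qed
  qed
qed

definition node_of :: "nat \<Rightarrow> 'v" where
  "node_of c = inv_into V enc (anchor c div 2)"

lemma node_of_core [simp]:
  assumes "v \<in> V"
  shows "node_of (inn v) = v" "node_of (out v) = v"
proof -
  have "inv_into V enc (enc v) = v"
    using enc assms by (rule bij_betw_inv_into_left)
  then show "node_of (inn v) = v" "node_of (out v) = v"
    using inn_less[OF assms] out_less[OF assms] core_le_core_end
    by (auto simp: node_of_def anchor_def inn_def out_def)
qed

text \<open>Contracting every vertex to its node maps the edges of the tree to arcs or to points.\<close>

lemma reachable_if_graph_connected_tree:
  assumes con: "graph_connected n (tree A)"
    and A: "A \<subseteq> arcs_available" "single_valued (A\<inverse>)"
  shows "V \<subseteq> A\<^sup>* `` {src}"
proof
  let ?S = "A\<^sup>* `` {src}"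
  have closed: "v \<in> ?S \<longleftrightarrow> w \<in> ?S" if "(v, w) \<in> A" for v w
  proof
    assume "w \<in> ?S"
    moreover have "w \<noteq> src" using that A(1) by (auto simp: arcs_available_def)
    ultimately obtain v' where "v' \<in> ?S" "(v', w) \<in> A" by (auto elim: rtranclE)
    then show "v \<in> ?S" using that A(2) by (auto dest: single_valuedD)
  qed (use that in \<open>auto intro: rtrancl_into_rtrancl\<close>)
  have edge: "node_of a \<in> ?S \<longleftrightarrow> node_of b \<in> ?S" if "{a, b} \<in> tree A" for a b
    using that
  proof (cases rule: tree_cases)
    case (hung u)
    then have "node_of (par u) = node_of u" by (simp add: node_of_def anchor_par)
    then show ?thesis using hung by (auto simp: doubleton_eq_iff)
  next
    case (arc v w)
    then have "v \<in> V" "w \<in> V" using A(1) by (auto simp: arcs_available_def)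
    then show ?thesis using arc closed[of v w] by (auto simp: doubleton_eq_iff)
  qed (auto simp: doubleton_eq_iff)
  fix v assume v: "v \<in> V"
  have "(\<lambda>a b. {a, b} \<in> tree A)\<^sup>*\<^sup>* (inn src) (inn v)"
    using con inn_less[OF src_in_V] inn_less[OF v] core_le_core_end core_end_le
    by (simp add: graph_connected_def)
  then have "node_of (inn v) \<in> ?S"
    by (induction rule: rtranclp_induct) (use src_in_V edge in auto)
  then show "v \<in> ?S" using v by simp
qed

lemma hamiltonian_path_subset_arcs_available:
  assumes "hamiltonian_path V src A"
  shows "A \<subseteq> arcs_available"
  using assms hamiltonian_path_irrefl[OF assms]
  by (auto simp: arcs_available_def hamiltonian_path_def)

lemma dc_tree_tree_iff:
  assumes A: "A \<subseteq> arcs_available"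
  shows "dc_tree n k (tree A) \<longleftrightarrow> hamiltonian_path V src A"
proof
  assume "dc_tree n k (tree A)"
  then have "graph_connected n (tree A)" "single_valued A" "single_valued (A\<inverse>)"
    using vdegree_tree_le_iff[OF A] by (auto simp: dc_tree_def spanning_tree_def)
  with reachable_if_graph_connected_tree[OF _ A] A show "hamiltonian_path V src A"
    by (auto simp: hamiltonian_path_def arcs_available_def)
next
  assume path: "hamiltonian_path V src A"
  then have AV: "A \<subseteq> V \<times> V" by (simp add: hamiltonian_path_def)
  have "card A + 1 = N" using card_hamiltonian_path[OF path finite_V src_in_V] card_V by simp
  moreover have "N \<le> n" using core_le_core_end core_end_le by simp
  ultimately have "card (tree A) < n" using card_tree_le[OF AV] by simp
  then have "spanning_tree n (tree A)"
    using path AV by (intro spanning_treeI tree_subset graph_connected_tree)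
      (auto simp: hamiltonian_path_def)
  moreover have "\<forall>c<n. vdegree (tree A) c \<le> k"
    using path vdegree_tree_le_iff[OF A] by (simp add: hamiltonian_path_def)
  ultimately show "dc_tree n k (tree A)" by (simp add: dc_tree_def)
qed

lemma set_between_tree: "set_between (tree A1) (tree A2) \<subseteq> tree ` set_between A1 A2"
proof
  fix T assume "T \<in> set_between (tree A1) (tree A2)"
  then have "T = tree {a \<in> A1 \<union> A2. arc_edge a \<in> T}"
    "{a \<in> A1 \<union> A2. arc_edge a \<in> T} \<in> set_between A1 A2"
    by (auto simp: set_between_iff tree_def)
  then show "T \<in> tree ` set_between A1 A2" by (rule image_eqI)
qed

lemma between_free_tree:
  assumes "between_free {A. hamiltonian_path V src A} \<A>"
  shows "between_free {T. dc_tree n k T} (tree ` \<A>)"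
  using assms
proof (rule between_free_image)
  note avail = hamiltonian_path_subset_arcs_available
  show "tree ` {A. hamiltonian_path V src A} \<subseteq> {T. dc_tree n k T}"
    using dc_tree_tree_iff[OF avail] by blast
  fix A1 A2 assume A12: "A1 \<in> {A. hamiltonian_path V src A}" "A2 \<in> {A. hamiltonian_path V src A}"
  show "{T. dc_tree n k T} \<inter> set_between (tree A1) (tree A2)
      \<subseteq> tree ` ({A. hamiltonian_path V src A} \<inter> set_between A1 A2)"
  proof
    fix T assume T: "T \<in> {T. dc_tree n k T} \<inter> set_between (tree A1) (tree A2)"
    then obtain A where A: "T = tree A" "A \<in> set_between A1 A2" using set_between_tree by blast
    then have "A \<subseteq> arcs_available"
      using avail[of A1] avail[of A2] A12 unfolding set_between_iff by blast
    then have "hamiltonian_path V src A" using dc_tree_tree_iff A(1) T by simp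
    then show "T \<in> tree ` ({A. hamiltonian_path V src A} \<inter> set_between A1 A2)"
      using A by blast
  qed
qed

end

lemma path_embedding_exists:
  assumes "finite V" "s \<in> V" "2 \<le> k" "2 * card V * (k - 1) \<le> n"
  obtains enc where "path_embedding n k (card V) V enc s"
  using assms ex_bij_betw_finite_nat[OF assms(1)]
  by (auto simp: path_embedding_def atLeast0LessThan)

lemma card_le_skel_clique_number_hamiltonian_paths:
  fixes idx :: "nat set \<Rightarrow> 'd::finite"
  assumes "bij_betw idx (Kn_edges n) UNIV" "2 \<le> k" "2 * card V * (k - 1) \<le> n"
    and "finite V" "s \<in> V" and \<A>: "between_free {A. hamiltonian_path V s A} \<A>"
  shows "card \<A> \<le> skel_clique_number (DCMST n k idx)"
proof -
  obtain enc where "path_embedding n k (card V) V enc s"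
    using path_embedding_exists assms by metis
  then interpret path_embedding n k "card V" V enc s .
  have "\<A> \<subseteq> Pow arcs_available"
    using \<A> hamiltonian_path_subset_arcs_available by (auto simp: between_free_def)
  then have "inj_on tree \<A>" using inj_on_tree by (rule inj_on_subset[rotated])
  then have "card \<A> = card (tree ` \<A>)" by (simp add: card_image)
  also have "\<dots> \<le> skel_clique_number (DCMST n k idx)"
    by (rule card_le_skel_clique_number_DCMST[OF assms(1) between_free_tree[OF \<A>]])
  finally show ?thesis .
qed

lemma dc_tree_exists:
  assumes "2 \<le> n" "2 \<le> k"
  obtains T where "dc_tree n k T"
proof -
  interpret path_embedding n 2 1 "{0 :: nat}" id 0
    by unfold_locales (use assms in \<open>auto simp: bij_betw_def\<close>)
  have "hamiltonian_path {0 :: nat} 0 {}" by (simp add: hamiltonian_path_def)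
  then have "dc_tree n 2 (tree {})" using dc_tree_tree_iff by simp
  then show thesis using that dc_tree_mono assms by blast
qed

lemma skel_clique_number_DCMST_pos:
  fixes idx :: "nat set \<Rightarrow> 'd::finite"
  assumes "bij_betw idx (Kn_edges n) UNIV" "2 \<le> n" "2 \<le> k"
  shows "0 < skel_clique_number (DCMST n k idx)"
proof -
  obtain T where "dc_tree n k T" using dc_tree_exists assms by blast
  then have "between_free {T. dc_tree n k T} {T}" by (auto simp: between_free_def)
  then have "card {T} \<le> skel_clique_number (DCMST n k idx)"
    by (rule card_le_skel_clique_number_DCMST[OF assms(1)])
  then show ?thesis by simp
qed

section \<open>Hamiltonian paths encoding systems of exclusive-or constraints\<close>

text \<open>
  Block b of the basic path consists of the segments (b, 0), ..., (b, 5), each identified with the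
  gap after it. The gaps (b, c) and (b, c + 3) with c < 3 form the chord (b, c); toggling it
  exchanges their targets. The three chords of a block cross pairwise, so the block is still
  traversed by a single path iff an even number of them is toggled.

  A variable u toggles all chords p with \<open>var p = u\<close> simultaneously. To enforce simultaneity,
  \<open>Item u t\<close> sits in chord t - 1 of u when u is true and in chord t when u is false.
\<close>

datatype 'u node = Seg "nat \<times> nat" | Item 'u nat

fun follow :: "nat \<times> nat \<Rightarrow> nat \<times> nat" where
  "follow (b, j) = (if j = 5 then (b + 1, 0) else (b, j + 1))"

fun mate :: "nat \<times> nat \<Rightarrow> nat \<times> nat" where
  "mate (b, j) = (b, (j + 3) mod 6)"

fun lower :: "nat \<times> nat \<Rightarrow> nat \<times> nat" where
  "lower (b, j) = (b, j mod 3)"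

locale xor_system =
  fixes B :: nat and var :: "nat \<times> nat \<Rightarrow> 'u"
begin

definition gaps :: "(nat \<times> nat) set" where "gaps = {..<B} \<times> {..<6}"
definition chords :: "(nat \<times> nat) set" where "chords = {..<B} \<times> {..<3}"
definition vars :: "'u set" where "vars = var ` chords"

definition occ :: "'u \<Rightarrow> (nat \<times> nat) set" where "occ u = {p \<in> chords. var p = u}"
abbreviation mult :: "'u \<Rightarrow> nat" where "mult u \<equiv> card (occ u)"
definition chord :: "'u \<Rightarrow> nat \<Rightarrow> nat \<times> nat" where "chord u = from_nat_into (occ u)"
definition pos :: "nat \<times> nat \<Rightarrow> nat" where "pos p = to_nat_on (occ (var p)) p"

definition inner_nodes :: "'u node set" where
  "inner_nodes = Seg ` gaps \<union> {Item u t | u t. 0 < t \<and> t < mult u}"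

definition nodes :: "'u node set" where
  "nodes = insert (Seg (B, 0)) inner_nodes"

fun switch :: "bool \<Rightarrow> 'u node \<Rightarrow> 'u node" where
  "switch s (Seg g) =
     (let t = pos g + of_bool s
      in if snd g < 3 \<and> 0 < t \<and> t < mult (var g) then Item (var g) t
         else Seg (follow (if s then mate g else g)))"
| "switch s (Item u t) = Seg (follow (if s then mate (chord u (t - 1)) else chord u t))"

fun own :: "'u node \<Rightarrow> 'u" where
  "own (Seg g) = var (lower g)"
| "own (Item u t) = u"

definition arcs :: "'u set \<Rightarrow> 'u node rel" where
  "arcs z = (\<lambda>v. (v, switch (own v \<in> z) v)) ` inner_nodes"

definition solution :: "'u set \<Rightarrow> bool" where
  "solution z \<longleftrightarrow> z \<subseteq> vars \<and> (\<forall>b<B. var (b, 2) \<in> z \<longleftrightarrow> (var (b, 0) \<in> z) \<noteq> (var (b, 1) \<in> z))"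

subsection \<open>The nodes\<close>

lemma finite_gaps [simp]: "finite gaps"
  and finite_chords [simp]: "finite chords"
  by (simp_all add: gaps_def chords_def)

lemma finite_occ [simp]: "finite (occ u)"
  by (simp add: occ_def)

lemma mate_mate: "g \<in> gaps \<Longrightarrow> mate (mate g) = g"
  and mate_in_gaps: "g \<in> gaps \<Longrightarrow> mate g \<in> gaps"
  and lower_in_chords: "g \<in> gaps \<Longrightarrow> lower g \<in> chords"
  and chords_subset_gaps: "chords \<subseteq> gaps"
  by (auto simp: gaps_def chords_def) presburger

lemma lower_mate [simp]: "lower (mate g) = lower g"
  by (cases g) (simp add: mod_mod_cancel)

lemma lower_chord: "p \<in> chords \<Longrightarrow> lower p = p"
  by (auto simp: chords_def)

lemma gap_lower_cases:
  assumes "g \<in> gaps"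
  obtains "g = lower g" | "g = mate (lower g)"
proof -
  obtain b j where g: "g = (b, j)" "j < 6" using assms by (auto simp: gaps_def)
  from g(2) consider "j < 3" | "j = 3" | "j = 4" | "j = 5" by linarith
  then have "g = lower g \<or> g = mate (lower g)" unfolding g(1) by cases simp_all
  then show thesis using that by blast
qed

lemma chord_in_occ: "t < mult u \<Longrightarrow> chord u t \<in> occ u"
  and pos_chord: "t < mult u \<Longrightarrow> pos (chord u t) = t"
proof -
  assume t: "t < mult u"
  show occ: "chord u t \<in> occ u"
    unfolding chord_def
    by (rule bij_betwE[OF bij_betw_from_nat_into_finite, rule_format]) (use t in simp_all)
  have "t \<in> to_nat_on (occ u) ` occ u"
    using to_nat_on_finite[OF finite_occ, of u] t by (simp add: bij_betw_def)
  moreover have "var (chord u t) = u" using occ by (simp add: occ_def)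
  ultimately show "pos (chord u t) = t" by (simp add: pos_def chord_def)
qed

lemma pos_less: "p \<in> chords \<Longrightarrow> pos p < mult (var p)"
  and chord_pos: "p \<in> chords \<Longrightarrow> chord (var p) (pos p) = p"
proof -
  assume "p \<in> chords"
  then have p: "p \<in> occ (var p)" by (simp add: occ_def)
  then show "pos p < mult (var p)"
    using bij_betwE[OF to_nat_on_finite[OF finite_occ, of "var p"]] by (simp add: pos_def)
  show "chord (var p) (pos p) = p"
    using p by (simp add: chord_def pos_def countable_finite)
qed

lemma chord_simps:
  assumes "t < mult u"
  shows "chord u t \<in> chords" "chord u t \<in> gaps" "var (chord u t) = u"
    "lower (chord u t) = chord u t" "mate (mate (chord u t)) = chord u t"
  using chord_in_occ[OF assms] chords_subset_gaps
  by (auto simp: occ_def lower_chord intro!: mate_mate)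

lemma switch_chord:
  assumes "t < mult u"
  shows "switch s (Seg (chord u t)) =
    (if 0 < t + of_bool s \<and> t + of_bool s < mult u then Item u (t + of_bool s)
     else Seg (follow (if s then mate (chord u t) else chord u t)))"
proof -
  have "snd (chord u t) < 3" using chord_simps(1)[OF assms] by (auto simp: chords_def)
  then show ?thesis using assms by (simp add: chord_simps pos_chord Let_def)
qed

lemma switch_mate_chord:
  assumes "t < mult u"
  shows "switch s (Seg (mate (chord u t))) =
    Seg (follow (if s then chord u t else mate (chord u t)))"
proof -
  obtain b c where "chord u t = (b, c)" "c < 3"
    using chord_simps(1)[OF assms] by (auto simp: chords_def)
  then have "\<not> snd (mate (chord u t)) < 3" by simp
  then show ?thesis using assms by (simp add: chord_simps Let_def del: mate.simps)
qed

lemma inner_nodes_cases: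
  assumes "v \<in> inner_nodes"
  obtains (lower) t where "t < mult (own v)" "v = Seg (chord (own v) t)"
    | (upper) t where "t < mult (own v)" "v = Seg (mate (chord (own v) t))"
    | (item) t where "0 < t" "t < mult (own v)" "v = Item (own v) t"
proof (cases v)
  case (Seg g)
  then have g: "g \<in> gaps" using assms by (auto simp: inner_nodes_def)
  then have "pos (lower g) < mult (own v)" "chord (own v) (pos (lower g)) = lower g"
    using Seg lower_in_chords pos_less chord_pos by simp_all
  then show thesis using gap_lower_cases[OF g] that(1,2) Seg by metis
next
  case (Item u t)
  then show thesis using assms that(3) by (auto simp: inner_nodes_def)
qed

lemma Seg_in_inner_nodes: "g \<in> gaps \<Longrightarrow> Seg g \<in> inner_nodes"
  by (simp add: inner_nodes_def)

lemma Item_in_nodes: "0 < t \<Longrightarrow> t < mult u \<Longrightarrow> Item u t \<in> nodes"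
  by (simp add: nodes_def inner_nodes_def)

lemma start_in_nodes: "Seg (0, 0) \<in> nodes"
  by (auto simp: nodes_def inner_nodes_def gaps_def image_iff)

lemma inner_nodes_eq: "inner_nodes = nodes - {Seg (B, 0)}"
  by (auto simp: nodes_def inner_nodes_def gaps_def)

lemma Seg_follow_in_nodes: "g \<in> gaps \<Longrightarrow> Seg (follow g) \<in> nodes"
  by (cases g) (auto simp: nodes_def inner_nodes_def gaps_def image_iff)

lemma switch_in_nodes:
  assumes "v \<in> inner_nodes"
  shows "switch s v \<in> nodes"
  using assms
proof (cases rule: inner_nodes_cases)
  case (lower t)
  then have "switch s v = (if 0 < t + of_bool s \<and> t + of_bool s < mult (own v)
      then Item (own v) (t + of_bool s)
      else Seg (follow (if s then mate (chord (own v) t) else chord (own v) t)))"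
    by (metis switch_chord)
  then show ?thesis
    using lower(1) by (simp add: Seg_follow_in_nodes Item_in_nodes mate_in_gaps chord_simps(2))
next
  case (upper t)
  then have "switch s v = Seg (follow (if s then chord (own v) t else mate (chord (own v) t)))"
    by (metis switch_mate_chord)
  then show ?thesis using upper(1) by (simp add: Seg_follow_in_nodes mate_in_gaps chord_simps(2))
next
  case (item t)
  then have "switch s v =
      Seg (follow (if s then mate (chord (own v) (t - 1)) else chord (own v) t))"
    by (metis switch.simps(2))
  then show ?thesis using item(1,2) by (simp add: Seg_follow_in_nodes mate_in_gaps chord_simps(2))
qed

lemma finite_vars: "finite vars" by (simp add: vars_def)

lemma less_mult_imp_vars: "t < mult u \<Longrightarrow> u \<in> vars"
  unfolding vars_def by (rule image_eqI[of _ _ "chord u t"]) (simp_all add: chord_simps)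

lemma mult_pos: "u \<in> vars \<Longrightarrow> 0 < mult u"
  by (auto simp: vars_def occ_def card_gt_0_iff)

lemma items_eq: "{Item u t | u t. 0 < t \<and> t < mult u} =
    (\<lambda>(u, t). Item u t) ` (SIGMA u:vars. {1..<mult u})"
  using less_mult_imp_vars by (auto simp: image_iff)

lemma finite_inner_nodes: "finite inner_nodes"
  by (simp add: inner_nodes_def items_eq finite_vars)

lemma finite_nodes: "finite nodes"
  by (simp add: nodes_def finite_inner_nodes)

lemma card_nodes_eq_Suc: "card nodes = Suc (card inner_nodes)"
proof -
  have "Seg (B, 0) \<notin> inner_nodes" by (simp add: inner_nodes_eq)
  then show ?thesis by (simp add: nodes_def finite_inner_nodes)
qed

lemma card_nodes: "card nodes + card vars = 9 * B + 1"
proof -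
  have "card (\<Union>u\<in>vars. occ u) = (\<Sum>u\<in>vars. mult u)"
    by (intro card_UN_disjoint) (auto simp: finite_vars occ_def)
  also have "(\<Union>u\<in>vars. occ u) = chords" by (auto simp: occ_def vars_def)
  finally have "(\<Sum>u\<in>vars. mult u) = 3 * B" by (simp add: chords_def)
  moreover have "(\<Sum>u\<in>vars. mult u) = (\<Sum>u\<in>vars. (mult u - 1) + 1)"
    using mult_pos by (intro sum.cong) auto
  ultimately have items: "(\<Sum>u\<in>vars. mult u - 1) + card vars = 3 * B"
    unfolding sum.distrib by simp
  have "inj_on (\<lambda>(u, t). Item u t) A" for A :: "('u \<times> nat) set" by (auto simp: inj_on_def)
  then have "card {Item u t | u t. 0 < t \<and> t < mult u} = (\<Sum>u\<in>vars. mult u - 1)"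
    unfolding items_eq by (simp add: card_image finite_vars)
  moreover have "card (Seg ` gaps :: 'u node set) = 6 * B"
    by (simp add: card_image inj_on_def gaps_def)
  moreover have "Seg ` gaps \<inter> {Item u t | u t. 0 < t \<and> t < mult u} = {}" by auto
  ultimately have "card inner_nodes = 6 * B + (\<Sum>u\<in>vars. mult u - 1)"
    unfolding inner_nodes_def items_eq by (subst card_Un_disjoint) (simp_all add: finite_vars)
  then show ?thesis using items by (simp add: card_nodes_eq_Suc)
qed

subsection \<open>Hamiltonicity\<close>

definition skip :: "'u set \<Rightarrow> nat \<times> nat \<Rightarrow> nat \<times> nat" where
  "skip z g = follow (if var (lower g) \<in> z then mate g else g)"

fun landing :: "'u set \<Rightarrow> 'u node \<Rightarrow> nat \<times> nat" where
  "landing z (Seg g) = g"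
| "landing z (Item u t) = follow (if u \<in> z then mate (chord u (t - 1)) else chord u t)"

lemma landing_succ_Seg:
  assumes "g \<in> gaps"
  shows "landing z (switch (own (Seg g) \<in> z) (Seg g)) = skip z g"
  using Seg_in_inner_nodes[OF assms]
proof (cases rule: inner_nodes_cases)
  case (lower t)
  define u where "u = own (Seg g)"
  have "g = chord u t" "t < mult u" using lower by (simp_all add: u_def)
  then show ?thesis
    by (cases "u \<in> z") (simp_all add: switch_chord skip_def chord_simps del: switch.simps)
next
  case (upper t)
  define u where "u = own (Seg g)"
  have "g = mate (chord u t)" "t < mult u" using upper by (simp_all add: u_def)
  then show ?thesis
    by (auto simp: switch_mate_chord skip_def chord_simps simp del: switch.simps)
qed simp

lemma succ_reachable: "v \<in> inner_nodes \<Longrightarrow> (v, switch (own v \<in> z) v) \<in> (arcs z)\<^sup>*"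
  by (auto simp: arcs_def)

lemma landing_reachable:
  assumes "v \<in> nodes"
  shows "(v, Seg (landing z v)) \<in> (arcs z)\<^sup>*"
proof (cases v)
  case (Item u t)
  then have "v \<in> inner_nodes" using assms by (auto simp: nodes_def)
  from succ_reachable[OF this, of z] show ?thesis by (simp add: Item)
qed simp

lemma skip_reachable:
  assumes "g \<in> gaps"
  shows "(Seg g, Seg (skip z g)) \<in> (arcs z)\<^sup>*"
proof -
  let ?v = "switch (own (Seg g) \<in> z) (Seg g)"
  have g: "Seg g \<in> inner_nodes" using assms by (rule Seg_in_inner_nodes)
  then have "(Seg g, ?v) \<in> (arcs z)\<^sup>*" by (rule succ_reachable)
  also have "(?v, Seg (landing z ?v)) \<in> (arcs z)\<^sup>*"
    using g by (intro landing_reachable switch_in_nodes)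
  finally show ?thesis unfolding landing_succ_Seg[OF assms] .
qed

lemma skip_block:
  "skip z (b, 0) = (b, if var (b, 0) \<in> z then 4 else 1)"
  "skip z (b, 1) = (b, if var (b, 1) \<in> z then 5 else 2)"
  "skip z (b, 2) = (if var (b, 2) \<in> z then (b + 1, 0) else (b, 3))"
  "skip z (b, 3) = (b, if var (b, 0) \<in> z then 1 else 4)"
  "skip z (b, 4) = (b, if var (b, 1) \<in> z then 2 else 5)"
  "skip z (b, 5) = (if var (b, 2) \<in> z then (b, 3) else (b + 1, 0))"
  by (simp_all add: skip_def)

lemma block_reachable:
  assumes "solution z" "b < B" "j < 6"
  shows "(Seg (b, 0), Seg (b, j)) \<in> (arcs z)\<^sup>*" "(Seg (b, 0), Seg (b + 1, 0)) \<in> (arcs z)\<^sup>*"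
proof -
  define R where "R i \<longleftrightarrow> (Seg (b, 0), Seg i) \<in> (arcs z)\<^sup>*" for i
  have step: "R (skip z (b, i))" if "R (b, i)" "i < 6" for i
    using that skip_reachable[of "(b, i)" z] \<open>b < B\<close>
    by (auto simp: R_def gaps_def intro: rtrancl_trans)
  have "R (b, 0)" by (simp add: R_def)
  moreover have "var (b, 2) \<in> z \<longleftrightarrow> (var (b, 0) \<in> z) \<noteq> (var (b, 1) \<in> z)"
    using assms by (simp add: solution_def)
  ultimately have "R (b, 0) \<and> R (b, 1) \<and> R (b, 2) \<and> R (b, 3) \<and> R (b, 4) \<and> R (b, 5) \<and> R (b + 1, 0)"
    using step[of 0] step[of 1] step[of 2] step[of 3] step[of 4] step[of 5]
    by (cases "var (b, 0) \<in> z"; cases "var (b, 1) \<in> z") (simp_all add: skip_block del: One_nat_def)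
  moreover have "j \<in> {0, 1, 2, 3, 4, 5}" using \<open>j < 6\<close> by auto
  ultimately show "(Seg (b, 0), Seg (b, j)) \<in> (arcs z)\<^sup>*"
    "(Seg (b, 0), Seg (b + 1, 0)) \<in> (arcs z)\<^sup>*"
    unfolding R_def by auto
qed

lemma nodes_reachable:
  assumes "solution z"
  shows "nodes \<subseteq> (arcs z)\<^sup>* `` {Seg (0, 0)}"
proof
  have start: "(Seg (0, 0), Seg (b, 0)) \<in> (arcs z)\<^sup>*" if "b \<le> B" for b
    using that
  proof (induction b)
    case (Suc b)
    then show ?case using block_reachable(2)[OF assms, of b 0] by simp
  qed simp
  have gap: "(Seg (0, 0), Seg g) \<in> (arcs z)\<^sup>*" if "g \<in> gaps" for g
    using that start block_reachable(1)[OF assms]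
    by (cases g) (auto simp: gaps_def intro: rtrancl_trans less_imp_le)
  have item: "(Seg (0, 0), Item u t) \<in> (arcs z)\<^sup>*" if t: "0 < t" "t < mult u" for u t
  proof -
    let ?g = "chord u (if u \<in> z then t - 1 else t)"
    have g: "?g \<in> gaps" using t by (simp add: chord_simps)
    have "own (Seg ?g) = u" using t by (simp add: chord_simps)
    moreover have "switch (u \<in> z) (Seg ?g) = Item u t"
      using t by (simp add: switch_chord del: switch.simps)
    ultimately have "(Seg ?g, Item u t) \<in> (arcs z)\<^sup>*"
      using succ_reachable[OF Seg_in_inner_nodes[OF g], of z] by simp
    with gap[OF g] show ?thesis by (rule rtrancl_trans)
  qed
  fix v assume "v \<in> nodes"
  then show "v \<in> (arcs z)\<^sup>* `` {Seg (0, 0)}"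
    using start[of B] gap item by (auto simp: nodes_def inner_nodes_def)
qed

lemma hamiltonian_path_arcs:
  assumes "solution z"
  shows "hamiltonian_path nodes (Seg (0, 0)) (arcs z)"
  using nodes_reachable[OF assms] unfolding arcs_def inner_nodes_eq
proof (rule hamiltonian_path_graphI[rotated 4])
  show "(\<lambda>v. switch (own v \<in> z) v) ` (nodes - {Seg (B, 0)}) \<subseteq> nodes"
    unfolding inner_nodes_eq[symmetric] using switch_in_nodes by blast
qed (simp_all add: finite_nodes start_in_nodes, simp add: nodes_def)

lemma landing_in_if_reachable:
  assumes "(Seg (0, 0), v) \<in> (arcs z)\<^sup>*" "(0, 0) \<in> G" "\<And>g. g \<in> G \<Longrightarrow> skip z g \<in> G"
  shows "landing z v \<in> G"
  using assms(1)
proof (induction rule: rtrancl_induct)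
  case (step v w)
  then have v: "v \<in> inner_nodes" "w = switch (own v \<in> z) v" by (auto simp: arcs_def)
  show ?case
  proof (cases v)
    case (Seg g)
    then have "g \<in> gaps" using v(1) by (auto simp: inner_nodes_def)
    then have "landing z w = skip z g" unfolding v(2) Seg by (rule landing_succ_Seg)
    then show ?thesis using step.IH Seg assms(3) by simp
  qed (use step.IH v(2) in simp)
qed (use assms(2) in simp)

lemma solution_if_hamiltonian_path_arcs:
  assumes path: "hamiltonian_path nodes (Seg (0, 0)) (arcs z)" and "z \<subseteq> vars"
  shows "solution z"
proof (rule ccontr)
  assume "\<not> solution z"
  then obtain b where b: "b < B"
    and odd: "\<not> (var (b, 2) \<in> z \<longleftrightarrow> (var (b, 0) \<in> z) \<noteq> (var (b, 1) \<in> z))"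
    using \<open>z \<subseteq> vars\<close> by (auto simp: solution_def)
  \<comment> \<open>The path leaves block b after three segments, none of which is (b, 3).\<close>
  define visited :: "(nat \<times> nat) set" where
    "visited = {(b, 0), (b, if var (b, 0) \<in> z then 4 else 1),
      (b, if (var (b, 0) \<in> z) = (var (b, 1) \<in> z) then 2 else 5)}"
  define G where "G = {g. fst g = b \<longrightarrow> g \<in> visited}"
  have "skip z g \<in> G" if "g \<in> G" for g
  proof (cases "fst g = b")
    case True
    then have "g \<in> visited" using that by (simp add: G_def)
    then show ?thesis using odd by (auto simp: visited_def G_def skip_def)
  next
    case False
    then show ?thesis by (cases g) (auto simp: G_def visited_def skip_def)
  qed
  moreover have "Seg (b, 3) \<in> nodes" using b by (simp add: nodes_def inner_nodes_def gaps_def)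
  then have "(Seg (0, 0), Seg (b, 3)) \<in> (arcs z)\<^sup>*" using path by (auto simp: hamiltonian_path_def)
  moreover have "(0, 0) \<in> G" by (auto simp: G_def visited_def)
  ultimately have "landing z (Seg (b, 3)) \<in> G" by (intro landing_in_if_reachable)
  then show False by (auto simp: G_def visited_def split: if_splits)
qed

subsection \<open>Hamiltonian paths in the union of two\<close>

definition linked :: "'u node rel" where
  "linked = {(v, w) \<in> inner_nodes \<times> inner_nodes. switch True v = switch False w}"

text \<open>The links run in a cycle through all nodes owned by u: up the chords, then down their mates
  and the items.\<close>

lemma linked_step:
  shows "Suc t < mult u \<Longrightarrow> (Seg (chord u t), Seg (chord u (Suc t))) \<in> linked"
    and "0 < mult u \<Longrightarrow> (Seg (chord u (mult u - 1)), Seg (mate (chord u (mult u - 1)))) \<in> linked"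
    and "0 < t \<Longrightarrow> t < mult u \<Longrightarrow> (Seg (mate (chord u t)), Item u t) \<in> linked"
    and "Suc t < mult u \<Longrightarrow> (Item u (Suc t), Seg (mate (chord u t))) \<in> linked"
    and "0 < mult u \<Longrightarrow> (Seg (mate (chord u 0)), Seg (chord u 0)) \<in> linked"
  by (simp_all add: linked_def switch_chord switch_mate_chord inner_nodes_def mate_in_gaps
      chord_simps del: switch.simps(1))

lemma linked_chord_chord:
  assumes "s \<le> t" "t < mult u"
  shows "(Seg (chord u s), Seg (chord u t)) \<in> linked\<^sup>*"
  using assms
proof (induction t rule: dec_induct)
  case (step t)
  then show ?case using linked_step(1)[of t u] by (simp add: rtrancl_into_rtrancl)
qed simp

lemma linked_mate_mate:
  assumes "s \<le> t" "t < mult u"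
  shows "(Seg (mate (chord u t)), Seg (mate (chord u s))) \<in> linked\<^sup>*"
  using assms
proof (induction t rule: dec_induct)
  case (step t)
  have "(Seg (mate (chord u (Suc t))), Item u (Suc t)) \<in> linked"
    using step.prems by (intro linked_step(3)) simp_all
  also have "(Item u (Suc t), Seg (mate (chord u t))) \<in> linked"
    using step.prems by (rule linked_step(4))
  also have "(Seg (mate (chord u t)), Seg (mate (chord u s))) \<in> linked\<^sup>*"
    using step by simp
  finally show ?case by (rule trancl_into_rtrancl)
qed simp

lemma linked_chord_mate:
  assumes "s < mult u" "t < mult u"
  shows "(Seg (chord u s), Seg (mate (chord u t))) \<in> linked\<^sup>*"
proof -
  let ?m = "mult u - 1"
  have "(Seg (chord u s), Seg (chord u ?m)) \<in> linked\<^sup>*"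
    using assms by (intro linked_chord_chord) simp_all
  also have "(Seg (chord u ?m), Seg (mate (chord u ?m))) \<in> linked"
    using assms by (intro linked_step(2)) simp
  also have "(Seg (mate (chord u ?m)), Seg (mate (chord u t))) \<in> linked\<^sup>*"
    using assms by (intro linked_mate_mate) simp_all
  finally show ?thesis .
qed

lemma linked_mate_chord:
  assumes "s < mult u" "t < mult u"
  shows "(Seg (mate (chord u s)), Seg (chord u t)) \<in> linked\<^sup>*"
proof -
  have "(Seg (mate (chord u s)), Seg (mate (chord u 0))) \<in> linked\<^sup>*"
    using assms by (intro linked_mate_mate) simp_all
  also have "(Seg (mate (chord u 0)), Seg (chord u 0)) \<in> linked"
    using assms by (intro linked_step(5)) simp
  also have "(Seg (chord u 0), Seg (chord u t)) \<in> linked\<^sup>*"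
    using assms by (intro linked_chord_chord) simp_all
  finally show ?thesis .
qed

lemma linked_hub:
  assumes "v \<in> inner_nodes"
  defines "hub \<equiv> Seg (chord (own v) 0)"
  shows "(hub, v) \<in> linked\<^sup>*" "(v, hub) \<in> linked\<^sup>*"
proof -
  define u where "u = own v"
  have "(hub, v) \<in> linked\<^sup>* \<and> (v, hub) \<in> linked\<^sup>*"
    using assms(1) unfolding hub_def u_def[symmetric]
  proof (cases rule: inner_nodes_cases)
    case (lower t)
    then have t: "t < mult u" "v = Seg (chord u t)" by (simp_all only: u_def)
    have "(Seg (chord u t), Seg (mate (chord u 0))) \<in> linked\<^sup>*"
      using t(1) by (intro linked_chord_mate) simp_all
    also have "(Seg (mate (chord u 0)), Seg (chord u 0)) \<in> linked\<^sup>*"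
      using t(1) by (intro linked_mate_chord) simp_all
    finally show "(Seg (chord u 0), v) \<in> linked\<^sup>* \<and> (v, Seg (chord u 0)) \<in> linked\<^sup>*"
      using t linked_chord_chord[of 0 t u] by simp
  next
    case (upper t)
    then have "t < mult u" "v = Seg (mate (chord u t))" by (simp_all only: u_def)
    then show "(Seg (chord u 0), v) \<in> linked\<^sup>* \<and> (v, Seg (chord u 0)) \<in> linked\<^sup>*"
      using linked_chord_mate[of 0 u t] linked_mate_chord[of t u 0] by simp
  next
    case (item t)
    then have t: "0 < t" "t < mult u" "v = Item u t" by (simp_all only: u_def)
    have "(Seg (chord u 0), Seg (mate (chord u t))) \<in> linked\<^sup>*"
      using t by (intro linked_chord_mate) simp_all
    also have "(Seg (mate (chord u t)), v) \<in> linked"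
      unfolding t(3) using t(1,2) by (rule linked_step(3))
    finally have hub_v: "(Seg (chord u 0), v) \<in> linked\<^sup>*" .
    have "(v, Seg (mate (chord u (t - 1)))) \<in> linked"
      using linked_step(4)[of "t - 1" u] t by simp
    also have "(Seg (mate (chord u (t - 1))), Seg (chord u 0)) \<in> linked\<^sup>*"
      using t by (intro linked_mate_chord) simp_all
    finally show "(Seg (chord u 0), v) \<in> linked\<^sup>* \<and> (v, Seg (chord u 0)) \<in> linked\<^sup>*"
      using hub_v by simp
  qed
  then show "(hub, v) \<in> linked\<^sup>*" "(v, hub) \<in> linked\<^sup>*" by simp_all
qed

lemma own_eq_imp_linked:
  assumes "v \<in> inner_nodes" "w \<in> inner_nodes" "own v = own w"
  shows "(v, w) \<in> linked\<^sup>*"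
  using linked_hub(2)[OF assms(1)] linked_hub(1)[OF assms(2)] assms(3) by simp

lemma switch_inject_upper:
  assumes "0 < mult u"
  shows "switch s (Seg (mate (chord u 0))) = switch s' (Seg (mate (chord u 0))) \<longleftrightarrow> s = s'"
proof -
  obtain b c where "chord u 0 = (b, c)" "c < 3"
    using chord_simps(1)[OF assms] by (auto simp: chords_def)
  then show ?thesis unfolding switch_mate_chord[OF assms] by auto
qed

lemma set_between_if_arcs_subset:
  assumes "arcs w \<subseteq> arcs x \<union> arcs y" "w \<subseteq> vars" "x \<subseteq> vars" "y \<subseteq> vars"
  shows "w \<in> set_between x y"
proof -
  have "(u \<in> w \<longleftrightarrow> u \<in> x) \<or> (u \<in> w \<longleftrightarrow> u \<in> y)" if "u \<in> vars" for u
  proof -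
    let ?v = "Seg (mate (chord u 0))"
    have m: "0 < mult u" using that by (rule mult_pos)
    then have v: "?v \<in> inner_nodes" "own ?v = u"
      by (simp_all add: inner_nodes_def mate_in_gaps chord_simps)
    have "(?v, switch (u \<in> w) ?v) \<in> arcs w" using v by (force simp: arcs_def)
    then have "(?v, switch (u \<in> w) ?v) \<in> arcs x \<union> arcs y" using assms(1) by blast
    then have "switch (u \<in> w) ?v = switch (u \<in> x) ?v \<or> switch (u \<in> w) ?v = switch (u \<in> y) ?v"
      using v(2) by (auto simp: arcs_def simp del: switch.simps own.simps)
    then show ?thesis unfolding switch_inject_upper[OF m] .
  qed
  then show ?thesis using assms(2-4) unfolding set_between_iff by blast
qed

lemma inj_on_arcs: "inj_on arcs (Pow vars)"
proof (rule inj_onI)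
  fix x y assume "x \<in> Pow vars" "y \<in> Pow vars" "arcs x = arcs y"
  then have "x \<in> set_between y y" using set_between_if_arcs_subset[of x y y] by blast
  then show "x = y" by simp
qed

lemma hamiltonian_path_switch_cases:
  assumes path: "hamiltonian_path nodes (Seg (0, 0)) A" and sub: "A \<subseteq> arcs x \<union> arcs y"
    and v: "v \<in> inner_nodes"
  shows "(v, switch True v) \<in> A \<or> (v, switch False v) \<in> A"
proof -
  have "inj_on fst A"
    using path by (auto simp: hamiltonian_path_def inj_on_def single_valued_def)
  then have "card (Domain A) = card A" by (simp add: Domain_fst card_image)
  also have "\<dots> = card inner_nodes"
    using card_hamiltonian_path[OF path finite_nodes start_in_nodes]
    by (simp add: card_nodes_eq_Suc)
  finally have "Domain A = inner_nodes"
    using finite_inner_nodes sub by (intro card_subset_eq) (auto simp: arcs_def)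
  then have "v \<in> Domain A" using v by simp
  then obtain w where w: "(v, w) \<in> A" by (rule DomainE)
  then have "w = switch (own v \<in> x) v \<or> w = switch (own v \<in> y) v"
    using sub by (auto simp: arcs_def)
  with w show ?thesis by (metis (full_types))
qed

lemma switch_True_linked:
  assumes "single_valued (A\<inverse>)"
    and on_or_off: "\<And>v. v \<in> inner_nodes \<Longrightarrow> (v, switch True v) \<in> A \<or> (v, switch False v) \<in> A"
    and "(v, w) \<in> linked\<^sup>*" "(v, switch True v) \<in> A"
  shows "(w, switch True w) \<in> A"
  using assms(3,4)
proof (induction rule: rtrancl_induct)
  case (step v' w')
  show ?case
  proof (rule ccontr)
    assume no: "(w', switch True w') \<notin> A"
    then have "(w', switch True v') \<in> A" using step.hyps(2) on_or_off by (auto simp: linked_def)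
    then have "w' = v'" using step.IH step.prems assms(1) by (auto dest: single_valuedD)
    then show False using no step.IH step.prems by simp
  qed
qed

lemma hamiltonian_path_subset_arcs_Un:
  assumes path: "hamiltonian_path nodes (Seg (0, 0)) A" and sub: "A \<subseteq> arcs x \<union> arcs y"
  obtains w where "w \<subseteq> vars" "A = arcs w"
proof
  note on_or_off = hamiltonian_path_switch_cases[OF path sub]
  have sv: "single_valued A" "single_valued (A\<inverse>)"
    using path by (simp_all add: hamiltonian_path_def)
  define w where "w = {own v | v. v \<in> inner_nodes \<and> (v, switch True v) \<in> A}"
  have on_iff: "own v \<in> w \<longleftrightarrow> (v, switch True v) \<in> A" if v: "v \<in> inner_nodes" for v
  proof
    assume "own v \<in> w"
    then obtain v' where v': "own v' = own v" "v' \<in> inner_nodes" "(v', switch True v') \<in> A"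
      by (auto simp: w_def)
    have "(v', v) \<in> linked\<^sup>*" using v'(2) v v'(1) by (rule own_eq_imp_linked)
    then show "(v, switch True v) \<in> A" using sv(2) on_or_off v'(3) switch_True_linked by blast
  qed (use v in \<open>auto simp: w_def\<close>)
  have "(v, switch (own v \<in> w) v) \<in> A" if "v \<in> inner_nodes" for v
    using on_iff[OF that] on_or_off[OF that] by (cases "own v \<in> w") simp_all
  then have succ: "arcs w \<subseteq> A" by (auto simp: arcs_def)
  moreover have "A \<subseteq> arcs w"
  proof
    fix p assume "p \<in> A"
    then obtain v v' where p: "p = (v, v')" "v \<in> inner_nodes" using sub by (auto simp: arcs_def)
    then have "(v, switch (own v \<in> w) v) \<in> arcs w" by (auto simp: arcs_def)
    moreover from this have "v' = switch (own v \<in> w) v"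
      using succ \<open>p \<in> A\<close> p(1) sv(1) by (auto dest: single_valuedD)
    ultimately show "p \<in> arcs w" using p(1) by simp
  qed
  ultimately show "A = arcs w" by (rule equalityI[rotated])
  have "own v \<in> vars" if "v \<in> inner_nodes" for v
    using that by (cases rule: inner_nodes_cases) (rule less_mult_imp_vars, assumption)+
  then show "w \<subseteq> vars" by (auto simp: w_def)
qed

lemma between_free_arcs:
  assumes "between_free {z. solution z} \<F>"
  shows "between_free {A. hamiltonian_path nodes (Seg (0, 0)) A} (arcs ` \<F>)"
  using assms
proof (rule between_free_image)
  show "arcs ` {z. solution z} \<subseteq> {A. hamiltonian_path nodes (Seg (0, 0)) A}"
    using hamiltonian_path_arcs by blast
  fix x y assume "x \<in> {z. solution z}" "y \<in> {z. solution z}"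
  then have xy: "x \<subseteq> vars" "y \<subseteq> vars" by (auto simp: solution_def)
  show "{A. hamiltonian_path nodes (Seg (0, 0)) A} \<inter> set_between (arcs x) (arcs y)
      \<subseteq> arcs ` ({z. solution z} \<inter> set_between x y)"
  proof
    fix A assume A: "A \<in> {A. hamiltonian_path nodes (Seg (0, 0)) A} \<inter> set_between (arcs x) (arcs y)"
    then have sub: "A \<subseteq> arcs x \<union> arcs y" by (simp add: set_between_iff)
    then obtain w where w: "w \<subseteq> vars" "A = arcs w"
      using hamiltonian_path_subset_arcs_Un A by blast
    then have "solution w" using solution_if_hamiltonian_path_arcs A by blast
    moreover have "w \<in> set_between x y" using set_between_if_arcs_subset sub w xy by blast
    ultimately show "A \<in> arcs ` ({z. solution z} \<inter> set_between x y)" using w(2) by blast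
  qed
qed

end

section \<open>Cuts of complete graphs\<close>

text \<open>The bit r of a subset of {0, ..., r - 1} is always 0, so the pair (i, r) records the bit i.\<close>

definition cut :: "nat \<Rightarrow> nat set \<Rightarrow> (nat \<times> nat) set" where
  "cut r x = {(i, j). i < j \<and> j \<le> r \<and> (i \<in> x) \<noteq> (j \<in> x)}"

lemma cut_last_iff: "x \<subseteq> {..<r} \<Longrightarrow> i < r \<Longrightarrow> (i, r) \<in> cut r x \<longleftrightarrow> i \<in> x"
  by (auto simp: cut_def)

lemma inj_on_cut: "inj_on (cut r) (Pow {..<r})"
proof (rule inj_onI)
  fix x y assume "x \<in> Pow {..<r}" "y \<in> Pow {..<r}" "cut r x = cut r y"
  then have "i \<in> x \<longleftrightarrow> i \<in> y" if "i < r" for i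
    using cut_last_iff[of x r i] cut_last_iff[of y r i] that by simp
  then show "x = y" using \<open>x \<in> Pow {..<r}\<close> \<open>y \<in> Pow {..<r}\<close> by blast
qed

lemma cut_between:
  assumes "a \<subseteq> {..<r}" "x \<subseteq> {..<r}" "y \<subseteq> {..<r}" "cut r a \<in> set_between (cut r x) (cut r y)"
  shows "a = x \<or> a = y"
proof (rule ccontr)
  assume "\<not> (a = x \<or> a = y)"
  then obtain i j where i: "i < r" "(i \<in> a) \<noteq> (i \<in> x)" and j: "j < r" "(j \<in> a) \<noteq> (j \<in> y)"
    using assms(1-3) by blast
  have agree: "(p \<in> cut r a \<longleftrightarrow> p \<in> cut r x) \<or> (p \<in> cut r a \<longleftrightarrow> p \<in> cut r y)" for p
    using assms(4) unfolding set_between_iff by blast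
  have "i \<in> a \<longleftrightarrow> i \<in> y" "j \<in> a \<longleftrightarrow> j \<in> x"
    using agree[of "(i, r)"] agree[of "(j, r)"] i j by (simp_all add: cut_last_iff assms(1-3))
  moreover from this have "i \<noteq> j" using i(2) by blast
  then consider "i < j" | "j < i" by linarith
  ultimately show False
    using agree[of "(i, j)"] agree[of "(j, i)"] i j by cases (simp_all add: cut_def, blast+)
qed

lemma between_free_cuts: "between_free (cut r ` Pow {..<r}) (cut r ` Pow {..<r})"
  by (auto simp: between_free_def dest: cut_between)

lemma cut_iff_triangles:
  "z \<in> cut r ` Pow {..<r} \<longleftrightarrow> z \<subseteq> {(i, j). i < j \<and> j \<le> r} \<and>
    (\<forall>i j. i < j \<and> j < r \<longrightarrow> ((i, j) \<in> z \<longleftrightarrow> ((i, r) \<in> z) \<noteq> ((j, r) \<in> z)))"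
  (is "_ \<longleftrightarrow> ?triangles")
proof
  assume z: ?triangles
  then have less: "i < j \<and> j \<le> r" if "(i, j) \<in> z" for i j
    using that by blast
  from z have triangle: "(i, j) \<in> z \<longleftrightarrow> ((i, r) \<in> z) \<noteq> ((j, r) \<in> z)" if "i < j" "j < r" for i j
    using that by blast
  define x where "x = {i. (i, r) \<in> z}"
  have "r \<notin> x" using less[of r r] by (auto simp: x_def)
  then have "(i, j) \<in> cut r x \<longleftrightarrow> (i, j) \<in> z" for i j
    using less[of i j] triangle[of i j] by (cases "j = r") (auto simp: cut_def x_def)
  then have "z = cut r x" by auto
  moreover have "x \<subseteq> {..<r}" using less by (auto simp: x_def)
  ultimately show "z \<in> cut r ` Pow {..<r}" by blast
qed (auto simp: cut_def)

lemma card_pairs_less: "2 * card {(i, j). i < j \<and> j < r} + r = r * (r :: nat)"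
proof -
  have "{(i, j). i < j \<and> j < r} = prod.swap ` (SIGMA j:{..<r}. {..<j})" by force
  then have "card {(i, j). i < j \<and> j < r} = (\<Sum>j<r. j)" by (simp add: card_image)
  moreover have "2 * (\<Sum>j<r. j) + r = r * r" by (induction r) auto
  ultimately show ?thesis by simp
qed

definition triangle_edge :: "nat \<Rightarrow> (nat \<Rightarrow> nat \<times> nat) \<Rightarrow> nat \<times> nat \<Rightarrow> nat \<times> nat" where
  "triangle_edge r pair = (\<lambda>(b, c).
     if c = 0 then (fst (pair b), r) else if c = 1 then (snd (pair b), r) else pair b)"

locale cut_system =
  fixes r B :: nat and pair :: "nat \<Rightarrow> nat \<times> nat"
  assumes r_ge_2: "2 \<le> r" and pair: "pair ` {..<B} = {(i, j). i < j \<and> j < r}"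
begin

sublocale xor_system B "triangle_edge r pair" .

lemma triangle_edge_simps [simp]:
  "triangle_edge r pair (b, 0) = (fst (pair b), r)"
  "triangle_edge r pair (b, Suc 0) = (snd (pair b), r)"
  "triangle_edge r pair (b, 2) = pair b"
  by (simp_all add: triangle_edge_def)

lemma vars_eq: "vars = {(i, j). i < j \<and> j \<le> r}"
proof -
  let ?P = "{(i, j). i < j \<and> j < r}"
  have "{..<3} = {0, Suc 0, 2 :: nat}" by auto
  then have "vars = (\<Union>b<B. (\<lambda>c. triangle_edge r pair (b, c)) ` {0, Suc 0, 2})"
    unfolding vars_def chords_def by blast
  also have "\<dots> = (\<Union>b<B. {(fst (pair b), r), (snd (pair b), r), pair b})" by simp
  also have "\<dots> = (\<Union>p\<in>pair ` {..<B}. {(fst p, r), (snd p, r), p})" by simp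
  also have "\<dots> = (\<Union>(i, j)\<in>?P. {(i, r), (j, r), (i, j)})" unfolding pair by auto
  also have "\<dots> = {(i, j). i < j \<and> j \<le> r}"
  proof (intro equalityI subsetI)
    fix p assume "p \<in> {(i, j). i < j \<and> j \<le> r}"
    then obtain i j where p: "p = (i, j)" "i < j" "j \<le> r" by auto
    then consider "j < r" | "j = r" "i = 0" | "j = r" "0 < i" by linarith
    then show "p \<in> (\<Union>(i, j)\<in>?P. {(i, r), (j, r), (i, j)})"
    proof cases
      case 2
      then show ?thesis using p r_ge_2 by (intro UN_I[of "(0, 1)"]) auto
    next
      case 3
      then show ?thesis using p by (intro UN_I[of "(0, i)"]) auto
    qed (use p in auto)
  qed auto
  finally show ?thesis .
qed

lemma solution_iff_cut: "solution z \<longleftrightarrow> z \<in> cut r ` Pow {..<r}"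
proof -
  have "(\<forall>b<B. \<phi> (pair b)) \<longleftrightarrow> (\<forall>(i, j) \<in> {(i, j). i < j \<and> j < r}. \<phi> (i, j))" for \<phi>
    unfolding pair[symmetric] by auto
  from this[of "\<lambda>p. p \<in> z \<longleftrightarrow> ((fst p, r) \<in> z) \<noteq> ((snd p, r) \<in> z)"]
  show ?thesis unfolding solution_def vars_eq cut_iff_triangles by simp
qed

end

lemma ex_hamiltonian_paths_between_free:
  assumes "2 \<le> r"
  obtains V :: "(nat \<times> nat) node set" and s \<A>
  where "finite V" "s \<in> V" "card V + 5 * r = 4 * r * r + 1" "card \<A> = 2 ^ r"
    "between_free {A. hamiltonian_path V s A} \<A>"
proof -
  define P where "P = {(i, j). i < j \<and> j < r}"
  have "finite P" by (rule finite_subset[of _ "{..<r} \<times> {..<r}"]) (auto simp: P_def)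
  then obtain pair where "bij_betw pair {..<card P} P"
    using ex_bij_betw_nat_finite by (metis atLeast0LessThan)
  then interpret cut_system r "card P" pair
    using assms by unfold_locales (simp_all add: bij_betw_def P_def)
  have solutions: "{z. solution z} = cut r ` Pow {..<r}" by (simp add: solution_iff_cut)
  show thesis
  proof (rule that[OF finite_nodes start_in_nodes])
    show "between_free {A. hamiltonian_path nodes (Seg (0, 0)) A} (arcs ` cut r ` Pow {..<r})"
      using between_free_cuts by (intro between_free_arcs) (simp add: solutions)
    have "cut r ` Pow {..<r} \<subseteq> Pow vars"
      unfolding solutions[symmetric] by (auto simp: solution_def)
    with inj_on_arcs have "inj_on arcs (cut r ` Pow {..<r})" by (rule inj_on_subset)
    then show "card (arcs ` cut r ` Pow {..<r}) = 2 ^ r"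
      by (simp add: card_image inj_on_cut card_Pow)
    have "2 * card vars = r * r + r"
      using card_pairs_less[of "Suc r"] by (simp add: vars_eq less_Suc_eq_le)
    moreover have "2 * card P + r = r * r" unfolding P_def by (rule card_pairs_less)
    ultimately show "card nodes + 5 * r = 4 * r * r + 1" using card_nodes by simp
  qed
qed

section \<open>The clique number\<close>

lemma two_power_le_skel_clique_number_DCMST:
  fixes idx :: "nat set \<Rightarrow> 'd::finite"
  assumes "bij_betw idx (Kn_edges n) UNIV" "2 \<le> k" "2 \<le> r"
    and size: "2 * (4 * r * r + 1 - 5 * r) * (k - 1) \<le> n"
  shows "2 ^ r \<le> skel_clique_number (DCMST n k idx)"
proof -
  obtain V :: "(nat \<times> nat) node set" and s \<A>
    where V: "finite V" "s \<in> V" "card V + 5 * r = 4 * r * r + 1"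
      and \<A>: "card \<A> = 2 ^ r" "between_free {A. hamiltonian_path V s A} \<A>"
    by (rule ex_hamiltonian_paths_between_free[OF \<open>2 \<le> r\<close>])
  have "card V = 4 * r * r + 1 - 5 * r" using V(3) by simp
  then have "card \<A> \<le> skel_clique_number (DCMST n k idx)"
    using V(1,2) \<A>(2) assms by (intro card_le_skel_clique_number_hamiltonian_paths) simp_all
  then show ?thesis using \<A>(1) by simp
qed

lemma two_powr_le_skel_clique_number_DCMST:
  fixes idx :: "nat set \<Rightarrow> 'd::finite" and e :: real
  assumes "bij_betw idx (Kn_edges n) UNIV" "2 \<le> k"
    and "0 \<le> e" "2 * e + 9 \<le> sqrt (real m)" "2 * m * (k - 1) \<le> n"
  shows "2 powr e \<le> real (skel_clique_number (DCMST n k idx))"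
proof -
  define r where "r = nat \<lfloor>e\<rfloor> + 2"
  have r: "2 \<le> r" "e \<le> real r" "real r \<le> e + 2"
    using \<open>0 \<le> e\<close> unfolding r_def by linarith+
  then have "(2 * real r + 5)\<^sup>2 \<le> real m"
    using assms(4) by (intro sqrt_ge_absD) simp
  then have "real ((2 * r + 5)\<^sup>2) \<le> real m" by simp
  then have "(2 * r + 5)\<^sup>2 \<le> m" by (simp only: of_nat_le_iff)
  then have "4 * r * r + 1 - 5 * r \<le> m" by (simp add: power2_eq_square algebra_simps)
  then have "2 * (4 * r * r + 1 - 5 * r) * (k - 1) \<le> 2 * m * (k - 1)"
    by (intro mult_right_mono mult_left_mono) simp_all
  then have "2 * (4 * r * r + 1 - 5 * r) * (k - 1) \<le> n" using assms(5) by (rule order_trans)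
  with assms(1,2) r(1) have "2 ^ r \<le> skel_clique_number (DCMST n k idx)"
    by (rule two_power_le_skel_clique_number_DCMST)
  then have "real (2 ^ r) \<le> real (skel_clique_number (DCMST n k idx))"
    by (simp only: of_nat_le_iff)
  moreover have "2 powr e \<le> 2 powr real r" using r(2) by (intro powr_mono) simp_all
  moreover have "2 powr real r = real (2 ^ r)" by (simp add: powr_realpow)
  ultimately show ?thesis by linarith
qed

theorem theorem9:
  fixes n k :: nat and idx :: "nat set \<Rightarrow> 'd::finite"
  assumes "n > 2" and "1 < k" and "k < n"
    and "bij_betw idx (Kn_edges n) (UNIV :: 'd set)"
  shows "real (skel_clique_number (DCMST n k idx))
           \<ge> 2 powr ((sqrt (real (((n - 2) div (k - 1) - 1) div 2)) - 9) / 2)"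
proof -
  define m where "m = ((n - 2) div (k - 1) - 1) div 2"
  define e where "e = (sqrt (real m) - 9) / 2"
  have "2 powr e \<le> real (skel_clique_number (DCMST n k idx))"
  proof (cases "e < 0")
    case True
    then have "2 powr e \<le> 2 powr 0" by (intro powr_mono) simp_all
    then show ?thesis
      using skel_clique_number_DCMST_pos[OF assms(4), of k] assms(1,2) by simp
  next
    case False
    have "2 * m * (k - 1) \<le> (n - 2) div (k - 1) * (k - 1)"
      by (intro mult_right_mono) (simp_all add: m_def)
    also have "\<dots> \<le> n" using div_times_less_eq_dividend[of "n - 2" "k - 1"] by linarith
    finally show ?thesis
      using False assms(2) by (intro two_powr_le_skel_clique_number_DCMST[OF assms(4)])
        (simp_all add: e_def field_simps)
  qed
  then show ?thesis by (simp add: e_def m_def)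
qed

end
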